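(* Let $q(x)=\sum_{n=1}^\infty q_n e^{inx}$ and $\tilde q(x)=\sum_{n=1}^\infty \tilde q_n e^{inx}$ with complex coefficients satisfying $\sum_n|q_n|^2<\infty$, $\sum_n|\tilde q_n|^2<\infty$, and let $\beta,\tilde\beta>0$. Let $\{\lambda_n, C_{11}(\lambda),C_{12}(\lambda)\}$ be the spectral data of the operator $L$ associated with $(q,\beta)$, and $\{\tilde\lambda_n,\tilde C_{11}(\lambda),\tilde C_{12}(\lambda)\}$ the spectral data of the operator $\tilde L$ associated with $(\tilde q,\tilde\beta)$. If the two sets of spectral data coincide, then $\beta=\tilde\beta$ and $q=\tilde q$ (i.e. $q_n=\tilde q_n$ for all $n\ge1$). In other words, the spectral data uniquely determine $\beta$ and the potential $q$.
   Context: Consider on the real line the equation $-y''(x)+q(x)y(x)=\lambda^2\rho(x)y(x)$, where $q(x)=\sum_{n=1}^\infty q_ne^{inx}$, $q_n\in\mathbb C$, $\sum_n|q_n|^2<\infty$, $\lambda\in\mathbb C$, $\rho(x)=1$ for $x\ge0$ and $\rho(x)=-\beta^2$ for $x<0$, with $\beta>0$. Solutions on the whole line satisfy $y(0+)=y(0-)$, $y'(0+)=y'(0-)$. $L$ is the operator generated by $\frac1{\rho(x)}\left\{-\frac{d^2}{dx^2}+q(x)\right\}$ in $L_2(-\infty,+\infty,\rho(x))$ (which as a set is $L_2(-\infty,+\infty)$), on its maximal domain: $y\in L_2$ with $y,y'$ locally absolutely continuous and $\rho^{-1}(-y''+qy)\in L_2$. Define numbers $V_{n\alpha}$ ($1\le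 n\le\alpha$) recursively by $$\alpha(\alpha-n)V_{n\alpha}+\sum_{s=n}^{\alpha-1}q_{\alpha-s}V_{ns}=0\quad(1\le n<\alpha),\qquad \alpha\sum_{n=1}^{\alpha}V_{n\alpha}+q_\alpha=0\quad(\alpha\ge 1);$$ it is known that $\sum_{n\ge1}\frac1n\sum_{\alpha\ge n}\alpha|V_{n\alpha}|<\infty$. The functions $$f_1^+(x,\lambda)=e^{i\lambda x}\Big(1+\sum_{n=1}^\infty\frac1{n+2\lambda}\sum_{\alpha=n}^\infty V_{n\alpha}e^{i\alpha x}\Big)\ (x\ge0),\qquad f_2^+(x,\lambda)=e^{\lambda\beta x}\Big(1+\sum_{n=1}^\infty\frac1{n-2i\lambda\beta}\sum_{\alpha=n}^\infty V_{n\alpha}e^{i\alpha x}\Big)\ (x<0)$$ are solutions of the equation on the indicated half-lines; values and derivatives at $x=0$ are the one-sided ones. Put $f_j^-(x,\lambda)=f_j^+(x,-\lambda)$, $j=1,2$. The Wronskian convention is $W[f,g]=f'g-fg'$ (so that $W[f_1^+,f_1^-]=2i\lambda$). Define the meromorphic-type coefficients $$C_{11}(\lambda)=\frac{W[f_2^+(0,\lambda),f_1^-(0,\lambda)]}{2i\lambda},\qquad C_{12}(\lambda)=\frac{W[f_1^+(0,\lambda),f_2^+(0,\lambda)]}{2i\lambda}$$ for all $\lambda\ne0$ at which the functions involved are defined. The spectral data of $L$ are $\{\lambda_n,C_{11}(\lambda),C_{12}(\lambda)\}$, where $\lambda_n$ are the eigenvalues of $L$ expressed in the parameter $\lambda$: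 the numbers $\lambda$, not real and not purely imaginary, such that $\lambda^2$ is an eigenvalue of $L$. *)

theory Defs
  imports "HOL-Analysis.Analysis"
begin

text \<open>
  Coefficient sequences are functions of type nat to complex of which only the values at
  indices n >= 1 matter. The spectral parameter is written z, the equation being
  - y'' + q y = z^2 rho y.
\<close>

definition fourier_sum :: "(nat \<Rightarrow> complex) \<Rightarrow> nat \<Rightarrow> real \<Rightarrow> complex" where
  "fourier_sum q N x = (\<Sum>n=1..N. q n * exp (\<i> * of_nat n * of_real x))"

text \<open>
  Square summability of the coefficients gives convergence of the Fourier series in the mean, so
  the potential is determined up to a null set: Q represents the sum of the series if the
  partial sums converge to Q in the square mean on every bounded interval.
\<close>

definition has_fourier_series :: "(real \<Rightarrow> complex) \<Rightarrow> (nat \<Rightarrow> complex) \<Rightarrow> bool" where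
  "has_fourier_series Q q \<longleftrightarrow>
     Q \<in> borel_measurable lebesgue \<and>
     (\<forall>a b. (\<lambda>N. \<integral>\<^sup>+x\<in>{a..b}. ennreal ((norm (Q x - fourier_sum q N x))\<^sup>2) \<partial>lebesgue)
              \<longlonglongrightarrow> 0)"


definition abs_continuous_on_interval :: "real \<Rightarrow> real \<Rightarrow> (real \<Rightarrow> complex) \<Rightarrow> bool" where
  "abs_continuous_on_interval a b f \<longleftrightarrow>
     (\<forall>\<epsilon>>0. \<exists>\<delta>>0. \<forall>(I :: nat set) u v.
        finite I \<and> (\<forall>i\<in>I. a \<le> u i \<and> u i \<le> v i \<and> v i \<le> b) \<and>
        disjoint_family_on (\<lambda>i. {u i<..<v i}) I \<and> (\<Sum>i\<in>I. v i - u i) < \<delta>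
        \<longrightarrow> (\<Sum>i\<in>I. norm (f (v i) - f (u i))) < \<epsilon>)"

definition locally_abs_continuous :: "(real \<Rightarrow> complex) \<Rightarrow> bool" where
  "locally_abs_continuous f \<longleftrightarrow> (\<forall>a b. abs_continuous_on_interval a b f)"

definition L2 :: "(real \<Rightarrow> complex) \<Rightarrow> bool" where
  "L2 f \<longleftrightarrow> f \<in> borel_measurable lebesgue \<and> integrable lebesgue (\<lambda>x. (norm (f x))\<^sup>2)"

definition rho :: "real \<Rightarrow> real \<Rightarrow> real" where
  "rho \<beta> x = (if x \<ge> 0 then 1 else - \<beta>\<^sup>2)"

abbreviation vderiv :: "(real \<Rightarrow> complex) \<Rightarrow> real \<Rightarrow> complex" where
  "vderiv f x \<equiv> vector_derivative f (at x)"

text \<open>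
  For y in the domain of L the second derivative exists almost everywhere; elsewhere
  vderiv yields an arbitrary value, which is irrelevant because the operator is only
  considered modulo null sets.
\<close>

definition L_op :: "(real \<Rightarrow> complex) \<Rightarrow> real \<Rightarrow> (real \<Rightarrow> complex) \<Rightarrow> real \<Rightarrow> complex" where
  "L_op Q \<beta> y x = (- vderiv (vderiv y) x + Q x * y x) / of_real (rho \<beta> x)"

text \<open>
  The matching conditions at 0 are contained in the requirement that y is differentiable
  everywhere with (locally absolutely) continuous derivative.
\<close>

definition L_domain :: "(real \<Rightarrow> complex) \<Rightarrow> real \<Rightarrow> (real \<Rightarrow> complex) set" where
  "L_domain Q \<beta> =
     {y. L2 y \<and> locally_abs_continuous y \<and> (\<forall>x. y differentiable (at x)) \<and>
         locally_abs_continuous (vderiv y) \<and> L2 (L_op Q \<beta> y)}"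

definition L_eigenvalue :: "(real \<Rightarrow> complex) \<Rightarrow> real \<Rightarrow> complex \<Rightarrow> bool" where
  "L_eigenvalue Q \<beta> \<mu> \<longleftrightarrow>
     (\<exists>y \<in> L_domain Q \<beta>. \<not> (AE x in lebesgue. y x = 0) \<and>
        (AE x in lebesgue. L_op Q \<beta> y x = \<mu> * y x))"

definition eigen_parameters :: "(real \<Rightarrow> complex) \<Rightarrow> real \<Rightarrow> complex set" where
  "eigen_parameters Q \<beta> = {z. Re z \<noteq> 0 \<and> Im z \<noteq> 0 \<and> L_eigenvalue Q \<beta> (z\<^sup>2)}"


text \<open>
  The value V q n a is the number with lower index n and upper index a; the two recursion
  equations are solved for it, as stated by the lemmas V_rec and V_diag below.
\<close>

function V :: "(nat \<Rightarrow> complex) \<Rightarrow> nat \<Rightarrow> nat \<Rightarrow> complex" where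
  "V q n a =
     (if n < 1 \<or> a < n then 0
      else if n < a then - (\<Sum>s=n..<a. q (a - s) * V q n s) / (of_nat a * of_nat (a - n))
      else - q a / of_nat a - (\<Sum>m=1..<a. V q m a))"
  by pat_completeness auto
termination
  by (relation "measures [\<lambda>(q, n, a). a, \<lambda>(q, n, a). n]") auto

declare V.simps [simp del]

lemma V_rec:
  assumes "1 \<le> n" "n < a"
  shows "of_nat a * (of_nat a - of_nat n) * V q n a + (\<Sum>s=n..a-1. q (a - s) * V q n s) = 0"
proof -
  have "{n..a-1} = {n..<a}" using assms by auto
  moreover have "of_nat a * (of_nat a - of_nat n :: complex) \<noteq> 0" using assms by auto
  ultimately show ?thesis
    using assms by (subst V.simps) (simp add: of_nat_diff)
qed

lemma V_diag:
  assumes "1 \<le> a"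
  shows "of_nat a * (\<Sum>n=1..a. V q n a) + q a = 0"
proof -
  have "{1..a} = insert a {1..<a}" using assms by auto
  then have "(\<Sum>n=1..a. V q n a) = V q a a + (\<Sum>n=1..<a. V q n a)" by simp
  also have "\<dots> = - q a / of_nat a" using assms by (subst V.simps) simp
  finally show ?thesis using assms by simp
qed

text \<open>
  The two functions are used only for n + 2 z and n - 2 i z \<beta> different from 0, i.e.
  on f1_dom and f2_dom. The inner and outer series are absolutely convergent there.
\<close>

definition f1_plus :: "(nat \<Rightarrow> complex) \<Rightarrow> complex \<Rightarrow> real \<Rightarrow> complex" where
  "f1_plus q z x = exp (\<i> * z * of_real x) *
     (1 + (\<Sum>\<^sub>\<infinity>n\<in>{1..}. 1 / (of_nat n + 2 * z) *
            (\<Sum>\<^sub>\<infinity>a\<in>{n..}. V q n a * exp (\<i> * of_nat a * of_real x))))"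

definition f2_plus :: "(nat \<Rightarrow> complex) \<Rightarrow> real \<Rightarrow> complex \<Rightarrow> real \<Rightarrow> complex" where
  "f2_plus q \<beta> z x = exp (z * of_real \<beta> * of_real x) *
     (1 + (\<Sum>\<^sub>\<infinity>n\<in>{1..}. 1 / (of_nat n - 2 * \<i> * z * of_real \<beta>) *
            (\<Sum>\<^sub>\<infinity>a\<in>{n..}. V q n a * exp (\<i> * of_nat a * of_real x))))"

definition f1_minus :: "(nat \<Rightarrow> complex) \<Rightarrow> complex \<Rightarrow> real \<Rightarrow> complex" where
  "f1_minus q z = f1_plus q (- z)"

definition f1_dom :: "complex set" where
  "f1_dom = {z. \<forall>n\<ge>1. of_nat n + 2 * z \<noteq> 0}"

definition f2_dom :: "real \<Rightarrow> complex set" where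
  "f2_dom \<beta> = {z. \<forall>n\<ge>1. of_nat n - 2 * \<i> * z * of_real \<beta> \<noteq> 0}"

text \<open>
  One-sided value and one-sided derivative at 0, as limits from the half-line on which the
  function is a solution: the right one for f1, the left one for f2.
\<close>

definition right_data :: "(real \<Rightarrow> complex) \<Rightarrow> complex \<times> complex" where
  "right_data f = (Lim (at_right 0) f, Lim (at_right 0) (vderiv f))"

definition left_data :: "(real \<Rightarrow> complex) \<Rightarrow> complex \<times> complex" where
  "left_data f = (Lim (at_left 0) f, Lim (at_left 0) (vderiv f))"

text \<open>The convention is W[f,g] = f' g - f g'; arguments are pairs (value, derivative).\<close>

definition wronskian :: "complex \<times> complex \<Rightarrow> complex \<times> complex \<Rightarrow> complex" where
  "wronskian f g = snd f * fst g - fst f * snd g"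

definition C11 :: "(nat \<Rightarrow> complex) \<Rightarrow> real \<Rightarrow> complex \<Rightarrow> complex" where
  "C11 q \<beta> z =
     wronskian (left_data (f2_plus q \<beta> z)) (right_data (f1_minus q z)) / (2 * \<i> * z)"

definition C12 :: "(nat \<Rightarrow> complex) \<Rightarrow> real \<Rightarrow> complex \<Rightarrow> complex" where
  "C12 q \<beta> z =
     wronskian (right_data (f1_plus q z)) (left_data (f2_plus q \<beta> z)) / (2 * \<i> * z)"

definition C11_dom :: "real \<Rightarrow> complex set" where
  "C11_dom \<beta> = {z. z \<noteq> 0 \<and> z \<in> f2_dom \<beta> \<and> - z \<in> f1_dom}"

definition C12_dom :: "real \<Rightarrow> complex set" where
  "C12_dom \<beta> = {z. z \<noteq> 0 \<and> z \<in> f1_dom \<and> z \<in> f2_dom \<beta>}"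

text \<open>
  The coefficients are compared as meromorphic-type functions: they have to agree wherever both
  defining expressions make sense, the complement being a discrete set. Equality of the sets
  C11_dom and C12_dom themselves is deliberately not required, since these sets depend on
  \<beta> only and would already reveal it, independently of the values of the coefficients.
\<close>

definition same_spectral_data ::
  "(real \<Rightarrow> complex) \<Rightarrow> (nat \<Rightarrow> complex) \<Rightarrow> real \<Rightarrow>
   (real \<Rightarrow> complex) \<Rightarrow> (nat \<Rightarrow> complex) \<Rightarrow> real \<Rightarrow> bool" where
  "same_spectral_data Q q \<beta> Q' q' \<beta>' \<longleftrightarrow>
     eigen_parameters Q \<beta> = eigen_parameters Q' \<beta>' \<and>
     (\<forall>z \<in> C11_dom \<beta> \<inter> C11_dom \<beta>'. C11 q \<beta> z = C11 q' \<beta>' z) \<and>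
     (\<forall>z \<in> C12_dom \<beta> \<inter> C12_dom \<beta>'. C12 q \<beta> z = C12 q' \<beta>' z)"

end

theory Submission
  imports Defs "HOL-Complex_Analysis.Cauchy_Integral_Formula"
begin

text \<open>
  Both C11 and C12 are bilinear in the value F and the derivative G at 0 of one Jost solution,
  taken at the spectral points z, - z and - i beta z. For large k in the right half-plane F tends
  to 1 and G / k to i, so the limit (1 - i beta) / 2 of C11 along the positive imaginary axis
  determines beta. F and G have simple poles at k = - n/2 with residues V q n n / 2 times their
  values at n/2, so the poles of C11 and C12 that come from f2_plus determine V q n n: the
  factors are values of C11 and C12 at the opposite point, and they cannot both vanish, because
  otherwise the Jost solution at n/2 would have zero data at 0, contradicting that
  the Wronskian of the solutions at k and - k is 2 i k. Finally the diagonal numbers V q n n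
  determine all q n recursively.
\<close>

text \<open>The obstacle is convergence: \<open>q\<close> is only square summable, so every estimate
  on \<open>V\<close> has to come from its recursion. What makes this work is the factor a (a + 2 k)
  in the recursion of \<open>jcoef\<close>. Apart from finitely many small a it grows quadratically,
  so one summable sequence dominates the coefficients for all k in a half-plane and, after
  multiplication by n + 2 k, for all k near the pole - n/2. Exchange of sums, derivatives,
  holomorphy, residues and the limit at infinity are then instances of dominated summation. Row n of
  \<open>V\<close> obeys the same recursion at k = n/2; this is why the residue at - n/2 is again
  given by the Jost solution at n/2. The two factors multiplying \<open>V q n n\<close> are, up to
  sign, Wronskians of the data at n/2 with the data at w and at - w, where w = i n / (2 beta). The
  data at w and - w have Wronskian 2 i w and so form a basis of the plane; both factors can vanish
  only if the data at n/2 do. This is why C11 and C12 are used together.\<close>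

text \<open>
  With jcoef, the function f1_plus q k becomes a single series
  exp (i k x) (jcoef q k 0 + jcoef q k 1 exp (i x) + ...), obtained by exchanging the two
  summations; f2_plus q beta z is the same function with k = - i beta z.
\<close>

definition jcoef :: "(nat \<Rightarrow> complex) \<Rightarrow> complex \<Rightarrow> nat \<Rightarrow> complex" where
  "jcoef q k a = (if a = 0 then 1 else \<Sum>n=1..a. V q n a / (of_nat n + 2 * k))"

section \<open>Recursions for the coefficients of the Jost series\<close>

lemma jcoef_0 [simp]: "jcoef q k 0 = 1"
  by (simp add: jcoef_def)

lemma V_eq_0: "n < 1 \<or> a < n \<Longrightarrow> V q n a = 0"
  by (subst V.simps) auto

text \<open>This compares the coefficients of exp (i (k + a) x) in - y'' + q y = k^2 y, because (k +
  a)^2 - k^2 = a (a + 2 k). Here it is deduced from \<open>V_rec\<close> and \<open>V_diag\<close>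
  by splitting a (a + 2 k) = a (a - n) + a (n + 2 k): the second part cancels the denominator of the
  n-th summand.\<close>

lemma jcoef_rec_pos:
  assumes k: "k \<in> f1_dom" and a: "1 \<le> a"
  shows "of_nat a * (of_nat a + 2 * k) * jcoef q k a = - (\<Sum>s<a. q (a - s) * jcoef q k s)"
proof -
  have nz: "of_nat n + 2 * k \<noteq> 0" if "n \<ge> 1" for n
    using k that by (auto simp: f1_dom_def)
  have *: "of_nat a * (of_nat a + 2 * k) * (V q n a / (of_nat n + 2 * k)) =
      of_nat a * V q n a - (\<Sum>s=n..a-1. q (a - s) * V q n s / (of_nat n + 2 * k))"
    if n: "n \<in> {1..a}" for n
  proof -
    have "of_nat a * (of_nat a - of_nat n) * V q n a = - (\<Sum>s=n..a-1. q (a - s) * V q n s)"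
    proof (cases "n < a")
      case True
      then show ?thesis using V_rec[of n a q] n by (simp add: add_eq_0_iff2)
    next
      case False
      then have "n = a" "{n..a-1} = {}" using n by auto
      then show ?thesis by simp
    qed
    then have "(\<Sum>s=n..a-1. q (a - s) * V q n s / (of_nat n + 2 * k)) =
      - (of_nat a * (of_nat a - of_nat n) * V q n a) / (of_nat n + 2 * k)"
      by (simp add: sum_divide_distrib)
    then show ?thesis using nz[of n] n by (simp add: field_simps)
  qed
  have "(\<Sum>n=1..a. \<Sum>s=n..a-1. q (a - s) * V q n s / (of_nat n + 2 * k))
      = (\<Sum>n=1..a. \<Sum>s=1..a-1. q (a - s) * V q n s / (of_nat n + 2 * k))"
    by (intro sum.cong refl sum.mono_neutral_left) (auto simp: V_eq_0)
  also have "\<dots> = (\<Sum>s=1..a-1. \<Sum>n=1..a. q (a - s) * V q n s / (of_nat n + 2 * k))"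
    by (rule sum.swap)
  also have "\<dots> = (\<Sum>s=1..a-1. q (a - s) * jcoef q k s)"
  proof (intro sum.cong refl)
    fix s assume s: "s \<in> {1..a-1}"
    have "(\<Sum>n=1..a. q (a - s) * V q n s / (of_nat n + 2 * k)) =
       (\<Sum>n=1..s. q (a - s) * V q n s / (of_nat n + 2 * k))"
      using s by (intro sum.mono_neutral_right) (auto simp: V_eq_0)
    then show "(\<Sum>n=1..a. q (a - s) * V q n s / (of_nat n + 2 * k)) = q (a - s) * jcoef q k s"
      using s by (simp add: jcoef_def sum_distrib_left)
  qed
  finally have sw: "(\<Sum>n=1..a. \<Sum>s=n..a-1. q (a - s) * V q n s / (of_nat n + 2 * k))
      = (\<Sum>s=1..a-1. q (a - s) * jcoef q k s)" .
  have "of_nat a * (of_nat a + 2 * k) * jcoef q k a =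
    (\<Sum>n=1..a. of_nat a * V q n a - (\<Sum>s=n..a-1. q (a - s) * V q n s / (of_nat n + 2 * k)))"
    using a * by (simp add: jcoef_def sum_distrib_left)
  also have "\<dots> = of_nat a * (\<Sum>n=1..a. V q n a) - (\<Sum>s=1..a-1. q (a - s) * jcoef q k s)"
    by (simp only: sum_subtractf sw sum_distrib_left)
  also have "of_nat a * (\<Sum>n=1..a. V q n a) = - q a"
    using V_diag[OF a, of q] by (simp add: add_eq_0_iff2)
  also have "- q a - (\<Sum>s=1..a-1. q (a - s) * jcoef q k s) = - (\<Sum>s<a. q (a - s) * jcoef q k s)"
  proof -
    have "{..<a} = insert 0 {1..a-1}" using a by auto
    then show ?thesis by simp
  qed
  finally show ?thesis .
qed

lemma Re_gt_f1_dom: "Re k > - 1 / 2 \<Longrightarrow> k \<in> f1_dom"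
proof -
  assume k: "Re k > - 1 / 2"
  have "of_nat n + 2 * k \<noteq> 0" if "n \<ge> 1" for n
  proof
    assume "of_nat n + 2 * k = 0"
    then have "Re (of_nat n + 2 * k) = 0" by simp
    then show False using k that by simp
  qed
  then show ?thesis by (auto simp: f1_dom_def)
qed

text \<open>At k = n/2 the factor j (j + 2 k) of \<open>jcoef_rec_pos\<close> is j (n + j), which is
  the factor in \<open>V_rec\<close> for the upper index n + j. Both sides thus solve one recursion
  with the same start at j = 0.\<close>

lemma V_jcoef:
  assumes "1 \<le> n"
  shows "V q n (n + j) = V q n n * jcoef q (of_nat n / 2) j"
proof (induction j rule: less_induct)
  case (less j)
  show ?case
  proof (cases "j = 0")
    case False
    have k: "(of_nat n / 2 :: complex) \<in> f1_dom" by (rule Re_gt_f1_dom) auto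
    have "of_nat (n + j) * of_nat j * V q n (n + j) = - (\<Sum>s=n..n+j-1. q (n + j - s) * V q n s)"
      using V_rec[of n "n + j" q] assms False by (simp add: add_eq_0_iff2)
    also have "(\<Sum>s=n..n+j-1. q (n + j - s) * V q n s) = (\<Sum>s<j. q (j - s) * V q n (n + s))"
      using False by (intro sum.reindex_bij_witness[of _ "\<lambda>s. n + s" "\<lambda>s. s - n"])
        (auto simp: add.commute)
    also have "\<dots> = V q n n * (\<Sum>s<j. q (j - s) * jcoef q (of_nat n / 2) s)"
      using less by (simp add: sum_distrib_left mult_ac)
    also have "\<dots> = - (V q n n * (of_nat j * (of_nat j + 2 * (of_nat n / 2)) * jcoef q (of_nat n / 2) j))"
      using jcoef_rec_pos[OF k, of j q] False by simp
    finally have "of_nat (n + j) * of_nat j * (V q n (n + j)) =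
      of_nat (n + j) * of_nat j * (V q n n * jcoef q (of_nat n / 2) j :: complex)"
      by (simp add: algebra_simps)
    moreover have "of_nat (n + j) * of_nat j \<noteq> (0::complex)" 
      using False by (metis add_is_0 mult_eq_0_iff of_nat_eq_0_iff)
    ultimately show ?thesis using mult_left_cancel by blast
  qed simp
qed

section \<open>Majorants\<close>

text \<open>
  A sequence that solves the recursion of the Jost coefficients with equality, up to the factor 2
  that absorbs the lower bound a/2 for norm (a + 2 k), and that does not depend on k.
\<close>

function majorant :: "(nat \<Rightarrow> real) \<Rightarrow> nat \<Rightarrow> real \<Rightarrow> nat \<Rightarrow> real" where
  "majorant p N M a =
     (if a \<le> N then M else 2 / (real a)\<^sup>2 * (\<Sum>s<a. p (a - s) * majorant p N M s))"
  by pat_completeness auto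
termination
  by (relation "measures [\<lambda>(p, N, M, a). a]") auto

declare majorant.simps [simp del]

lemma majorant_nonneg:
  assumes "\<And>j. p j \<ge> 0" "M \<ge> 0"
  shows "majorant p N M a \<ge> 0"
proof (induction a rule: less_induct)
  case (less a)
  then show ?case using assms
    by (subst majorant.simps) (auto intro!: mult_nonneg_nonneg sum_nonneg divide_nonneg_nonneg)
qed

lemma le_majorant:
  assumes p: "\<And>j. p j \<ge> 0"
    and "\<And>a. a \<le> N \<Longrightarrow> x a \<le> M"
    and "\<And>a. N < a \<Longrightarrow> (real a)\<^sup>2 / 2 * x a \<le> (\<Sum>s<a. p (a - s) * x s)"
  shows "x a \<le> majorant p N M a"
proof (induction a rule: less_induct)
  case (less a)
  show ?case
  proof (cases "a \<le> N")
    case True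
    then show ?thesis using assms(2) by (subst majorant.simps) auto
  next
    case False
    have "(real a)\<^sup>2 / 2 * x a \<le> (\<Sum>s<a. p (a - s) * x s)"
      using assms(3)[of a] False by simp
    also have "\<dots> \<le> (\<Sum>s<a. p (a - s) * majorant p N M s)"
      using less p by (intro sum_mono mult_left_mono) auto
    finally have "(real a)\<^sup>2 / 2 * x a \<le> (\<Sum>s<a. p (a - s) * majorant p N M s)" .
    moreover have "majorant p N M a = 2 / (real a)\<^sup>2 * (\<Sum>s<a. p (a - s) * majorant p N M s)"
      using False by (subst majorant.simps) auto
    ultimately have "(real a)\<^sup>2 / 2 * x a \<le> (real a)\<^sup>2 / 2 * majorant p N M a"
      using False by simp
    moreover have "(real a)\<^sup>2 / 2 > 0" using False by simp
    ultimately show ?thesis by (simp only: mult_le_cancel_left_pos)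
  qed
qed

text \<open>A discrete Gronwall argument: past \<open>N\<close> the partial sums S satisfy S(a + 1)
  <= (1 + 2 P / a^2) S(a), and 1 + t <= exp t. The first N + 1 terms account for (N + 1) M; the
  summand s = 0 in the exponent is 1 / 0 = 0.\<close>

lemma majorant_bounded_sum:
  assumes p: "\<And>j. p j \<ge> 0" and P: "\<And>j. p j \<le> P" and M: "M \<ge> 0"
  shows "(\<Sum>s<a. majorant p N M s) \<le> (real N + 1) * M * exp (2 * P * (\<Sum>s<a. 1 / (real s)\<^sup>2))"
proof (induction a)
  case 0
  then show ?case using M by simp
next
  case (Suc a)
  let ?S = "\<Sum>s<a. majorant p N M s"
  have P0: "P \<ge> 0" using p[of 0] P[of 0] by linarith
  have S0: "?S \<ge> 0" using p M by (intro sum_nonneg majorant_nonneg) auto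
  show ?case
  proof (cases "a \<le> N")
    case True
    have "(\<Sum>s<Suc a. majorant p N M s) = (\<Sum>s<Suc a. M)"
      using True by (intro sum.cong refl) (subst majorant.simps, auto)
    also have "\<dots> \<le> (real N + 1) * M * 1" 
      using True M by (auto intro!: mult_right_mono)
    also have "\<dots> \<le> (real N + 1) * M * exp (2 * P * (\<Sum>s<Suc a. 1 / (real s)\<^sup>2))"
      using M P0 by (intro mult_left_mono) (auto intro!: mult_nonneg_nonneg sum_nonneg add_nonneg_nonneg)
    finally show ?thesis .
  next
    case False
    have "majorant p N M a = 2 / (real a)\<^sup>2 * (\<Sum>s<a. p (a - s) * majorant p N M s)"
      using False by (subst majorant.simps) auto
    also have "\<dots> \<le> 2 / (real a)\<^sup>2 * (\<Sum>s<a. P * majorant p N M s)"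
      using p P M by (intro mult_left_mono sum_mono mult_right_mono majorant_nonneg) auto
    also have "\<dots> = 2 * P * (1 / (real a)\<^sup>2) * ?S"
      by (simp only: sum_distrib_left [symmetric] mult_ac) simp
    finally have le: "majorant p N M a \<le> 2 * P * (1 / (real a)\<^sup>2) * ?S" .
    have "(\<Sum>s<Suc a. majorant p N M s) = ?S + majorant p N M a" by simp
    also have "\<dots> \<le> ?S + 2 * P * (1 / (real a)\<^sup>2) * ?S" using le by (rule add_left_mono)
    also have "\<dots> = ?S * (1 + 2 * P * (1 / (real a)\<^sup>2))"
      by (simp only: distrib_left mult_1_right mult.commute)
    finally have "(\<Sum>s<Suc a. majorant p N M s) \<le> ?S * (1 + 2 * P * (1 / (real a)\<^sup>2))" .
    also have "\<dots> \<le> ?S * exp (2 * P * (1 / (real a)\<^sup>2))"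
      using S0 by (intro mult_left_mono exp_ge_add_one_self) auto
    also have "\<dots> \<le> ((real N + 1) * M * exp (2 * P * (\<Sum>s<a. 1 / (real s)\<^sup>2))) * exp (2 * P * (1 / (real a)\<^sup>2))"
      using Suc by (intro mult_right_mono) auto
    also have "\<dots> = (real N + 1) * M * exp (2 * P * (\<Sum>s<Suc a. 1 / (real s)\<^sup>2))"
      by (simp add: exp_add [symmetric] distrib_left)
    finally show ?thesis .
  qed
qed

lemma square_summable_bounded:
  fixes p :: "nat \<Rightarrow> real"
  assumes "summable (\<lambda>n. (p n)\<^sup>2)"
  obtains P where "\<And>n. p n \<le> P" "P > 0"
proof -
  have "Bseq (\<lambda>n. (p n)\<^sup>2)" 
    by (rule summable_LIMSEQ_zero[OF assms, THEN convergentI, THEN convergent_imp_Bseq])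
  then obtain K where K: "K > 0" "\<And>n. norm ((p n)\<^sup>2) \<le> K" by (auto elim: BseqE)
  have "p n \<le> sqrt K" for n
    using K(2)[of n] by (intro real_le_rsqrt) auto
  then show ?thesis using that[of "sqrt K"] K by auto
qed

lemma summable_majorant:
  assumes p: "\<And>j. p j \<ge> 0" and sq: "summable (\<lambda>j. (p j)\<^sup>2)" and M: "M \<ge> 0"
  shows "summable (majorant p N M)"
proof -
  obtain P where P: "\<And>n. p n \<le> P" "P > 0" using square_summable_bounded[OF sq] by metis
  have "summable (\<lambda>s. 1 / (real s)\<^sup>2)" using inverse_power_summable[of 2] by (simp add: field_simps)
  then have "(\<Sum>s<a. 1 / (real s)\<^sup>2) \<le> (\<Sum>s. 1 / (real s)\<^sup>2)" for a
    by (intro sum_le_suminf) auto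
  then have "(real N + 1) * M * exp (2 * P * (\<Sum>s<a. 1 / (real s)\<^sup>2))
     \<le> (real N + 1) * M * exp (2 * P * (\<Sum>s. 1 / (real s)\<^sup>2))" for a
    using M P(2) by (intro mult_left_mono) auto
  then have "(\<Sum>s<a. majorant p N M s) \<le> (real N + 1) * M * exp (2 * P * (\<Sum>s. 1 / (real s)\<^sup>2))" for a
    using order_trans[OF majorant_bounded_sum[OF p P(1) M]] by auto
  then show ?thesis
    using majorant_nonneg[of p M N] p M by (intro summableI_nonneg_bounded) auto
qed

text \<open>One of the two powers of a in the recursion pays for the weight, the other is traded for
  square summability: 2 p(a - s) / a <= 2 p(a - s) / (a - s) <= 1 / (a - s)^2 + p(a - s)^2. The
  weighted sequence is therefore dominated by a Cauchy product of two summable sequences.\<close>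

lemma summable_mult_majorant:
  assumes p: "\<And>j. p j \<ge> 0" and sq: "summable (\<lambda>j. (p j)\<^sup>2)" and M: "M \<ge> 0"
  shows "summable (\<lambda>a. real a * majorant p N M a)"
proof -
  let ?B = "majorant p N M" and ?h = "\<lambda>j. 1 / (real j)\<^sup>2 + (p j)\<^sup>2"
  have B: "?B s \<ge> 0" for s using majorant_nonneg p M by blast
  have "summable (\<lambda>s. 1 / (real s)\<^sup>2)" using inverse_power_summable[of 2] by (simp add: field_simps)
  then have "summable ?h" using sq by (rule summable_add)
  then have "summable (\<lambda>a. \<Sum>i\<le>a. ?B i * ?h (a - i))"
    using summable_majorant[OF assms, of N] B
    by (intro summable_Cauchy_product) (auto)
  moreover have "norm (real a * ?B a) \<le> (\<Sum>i\<le>a. ?B i * ?h (a - i))" if "N < a" for a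
  proof -
    have le: "2 / real a * p (a - s) \<le> ?h (a - s)" if "s < a" for s
    proof -
      have "2 / real a * p (a - s) \<le> 2 / real (a - s) * p (a - s)"
        using that p by (intro mult_right_mono divide_left_mono) auto
      also have "\<dots> \<le> (1 / real (a - s))\<^sup>2 + (p (a - s))\<^sup>2"
        using sum_squares_bound[of "1 / real (a - s)" "p (a - s)"] by simp
      finally show ?thesis by (simp add: power_divide)
    qed
    have "real a * ?B a = real a * (2 / (real a)\<^sup>2 * (\<Sum>s<a. p (a - s) * ?B s))"
      using that by (subst majorant.simps) auto
    also have "\<dots> = (\<Sum>s<a. ?B s * (2 / real a * p (a - s)))"
      using that by (simp add: sum_distrib_left power2_eq_square mult_ac)
    also have "\<dots> \<le> (\<Sum>s<a. ?B s * ?h (a - s))"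
      using le B by (intro sum_mono mult_left_mono) auto
    also have "\<dots> \<le> (\<Sum>s\<le>a. ?B s * ?h (a - s))"
      using B by (intro sum_mono2) auto
    finally show ?thesis using B by simp
  qed
  ultimately show ?thesis
    by (intro summable_comparison_test[where f = "\<lambda>a. real a * ?B a"]) (auto intro!: exI[of _ "Suc N"])
qed

section \<open>The Jost data at the origin\<close>

definition jost_value :: "(nat \<Rightarrow> complex) \<Rightarrow> complex \<Rightarrow> complex" where
  "jost_value q k = (\<Sum>a. jcoef q k a)"

definition jost_deriv :: "(nat \<Rightarrow> complex) \<Rightarrow> complex \<Rightarrow> complex" where
  "jost_deriv q k = (\<Sum>a. \<i> * (k + of_nat a) * jcoef q k a)"

lemma jcoef_rec:
  assumes k: "k \<in> f1_dom"
  shows "of_nat a * (of_nat a + 2 * k) * jcoef q k a = - (\<Sum>s<a. q (a - s) * jcoef q k s)"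
  using jcoef_rec_pos[OF k, of a q] by (cases "a = 0") auto

text \<open>The scalar \<open>c\<close> is 1 for regular k, and n + 2 k when k approaches the pole -
  n/2. The recursion is linear and survives the scaling; only the first N + 1 terms, where a + 2 k
  may be small, need a separate bound.\<close>

lemma jcoef_le_majorant:
  assumes k: "k \<in> f1_dom"
    and M: "\<And>a. a \<le> N \<Longrightarrow> norm (c * jcoef q k a) \<le> M"
    and far: "\<And>a. N < a \<Longrightarrow> real a / 2 \<le> norm (of_nat a + 2 * k)"
  shows "norm (c * jcoef q k a) \<le> majorant (\<lambda>j. norm (q j)) N M a"
proof (rule le_majorant)
  fix a assume a: "N < a"
  have "(real a)\<^sup>2 / 2 * norm (c * jcoef q k a) = real a * (real a / 2) * norm (c * jcoef q k a)"
    by (simp add: power2_eq_square)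
  also have "\<dots> \<le> real a * norm (of_nat a + 2 * k) * norm (c * jcoef q k a)"
    using far[OF a] by (intro mult_right_mono mult_left_mono) auto
  also have "\<dots> = norm (c * (of_nat a * (of_nat a + 2 * k) * jcoef q k a))"
    by (simp add: norm_mult)
  also have "\<dots> = norm (\<Sum>s<a. c * (q (a - s) * jcoef q k s))"
    unfolding jcoef_rec[OF k] by (simp add: sum_distrib_left norm_minus_cancel)
  also have "\<dots> \<le> (\<Sum>s<a. norm (c * (q (a - s) * jcoef q k s)))"
    by (rule norm_sum)
  also have "\<dots> = (\<Sum>s<a. norm (q (a - s)) * norm (c * jcoef q k s))"
    by (simp add: norm_mult mult_ac)
  finally show "(real a)\<^sup>2 / 2 * norm (c * jcoef q k a) \<le> (\<Sum>s<a. norm (q (a - s)) * norm (c * jcoef q k s))" .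
qed (use M in auto)

lemma half_le_norm_of_nat_add:
  fixes k :: complex
  assumes "norm k \<le> r" "nat \<lceil>4 * r\<rceil> < a"
  shows "real a / 2 \<le> norm (of_nat a + 2 * k)"
proof -
  have "4 * r \<le> real a" using assms(2) by linarith
  moreover have "norm (of_nat a :: complex) - norm (2 * k) \<le> norm (of_nat a + 2 * k)"
    using norm_triangle_ineq2[of "of_nat a" "- (2 * k)"] by simp
  ultimately show ?thesis using assms(1) by (simp add: norm_mult)
qed

text \<open>For a >= 1 one has a + 2 Re k >= a - 1/2 >= a/2. Hence N = 0 and M = 1 are a uniform
  choice in \<open>majorant\<close> on this half-plane, which contains all points n/2 and a
  neighbourhood of the imaginary axis.\<close>

lemma Re_half_le_norm_of_nat_add:
  fixes k :: complex
  assumes "Re k \<ge> - 1 / 4" "0 < a"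
  shows "real a / 2 \<le> norm (of_nat a + 2 * k)"
proof -
  have "real a / 2 \<le> Re (of_nat a + 2 * k)" using assms by simp
  then show ?thesis using complex_Re_le_cmod order_trans by blast
qed

locale square_summable =
  fixes q :: "nat \<Rightarrow> complex"
  assumes square_summable: "summable (\<lambda>n. (norm (q n))\<^sup>2)"
begin

lemma summable_mult_majorant_q: 
  assumes "M \<ge> 0"
  shows "summable (\<lambda>a. real a * majorant (\<lambda>j. norm (q j)) N M a)"
    and "summable (majorant (\<lambda>j. norm (q j)) N M)"
  using summable_mult_majorant summable_majorant square_summable assms by simp_all

lemma summable_jcoef:
  assumes k: "k \<in> f1_dom"
  shows "summable (\<lambda>a. norm (jcoef q k a))" and "summable (\<lambda>a. real a * norm (jcoef q k a))"
proof -
  define N where "N = nat \<lceil>4 * norm k\<rceil>"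
  define M where "M = (\<Sum>a\<le>N. norm (jcoef q k a))"
  have "norm (jcoef q k a) \<le> majorant (\<lambda>j. norm (q j)) N M a" for a
  proof -
    have "norm (1 * jcoef q k a) \<le> majorant (\<lambda>j. norm (q j)) N M a"
    proof (rule jcoef_le_majorant[OF k])
      fix a assume "a \<le> N"
      then have "norm (jcoef q k a) \<le> M" unfolding M_def by (intro member_le_sum) auto
      then show "norm (1 * jcoef q k a) \<le> M" by simp
    qed (use half_le_norm_of_nat_add[OF order_refl] N_def in blast)
    then show ?thesis by simp
  qed
  moreover have "M \<ge> 0" unfolding M_def by (intro sum_nonneg) auto
  ultimately show "summable (\<lambda>a. norm (jcoef q k a))" "summable (\<lambda>a. real a * norm (jcoef q k a))"
    by (auto intro!: summable_comparison_test'[OF summable_mult_majorant_q(2)[of M N], where N = 0]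
      summable_comparison_test'[OF summable_mult_majorant_q(1)[of M N], where N = 0 and f = "\<lambda>a. real a * norm (jcoef q k a)"]
      mult_left_mono)
qed

lemma sums_jost:
  assumes k: "k \<in> f1_dom"
  shows "jcoef q k sums jost_value q k"
    and "(\<lambda>a. \<i> * (k + of_nat a) * jcoef q k a) sums jost_deriv q k"
    and "summable (\<lambda>a. norm (\<i> * (k + of_nat a) * jcoef q k a))"
proof -
  note s = summable_jcoef[OF k]
  show "jcoef q k sums jost_value q k"
    unfolding jost_value_def by (rule summable_sums[OF summable_norm_cancel[OF s(1)]])
  have s1: "summable (\<lambda>a. norm k * norm (jcoef q k a) + real a * norm (jcoef q k a))"
    using s by (intro summable_add summable_mult)
  have le: "norm (\<i> * (k + of_nat a) * jcoef q k a)
      \<le> norm k * norm (jcoef q k a) + real a * norm (jcoef q k a)" for a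
    using norm_triangle_ineq[of k "of_nat a"] 
    by (simp add: norm_mult mult_right_mono flip: distrib_right)
  show s': "summable (\<lambda>a. norm (\<i> * (k + of_nat a) * jcoef q k a))"
    by (rule summable_comparison_test'[OF s1, where N = 0]) (use le in simp)
  show "(\<lambda>a. \<i> * (k + of_nat a) * jcoef q k a) sums jost_deriv q k"
    unfolding jost_deriv_def by (rule summable_sums[OF summable_norm_cancel[OF s']])
qed

text \<open>
  The Wronskian at 0 is evaluated as a Cauchy product: the recursion makes all its terms except
  the first one vanish, so no differential equation is needed.
\<close>

lemma jost_wronskian:
  assumes k: "k \<in> f1_dom" and mk: "- k \<in> f1_dom"
  shows "jost_deriv q k * jost_value q (- k) - jost_value q k * jost_deriv q (- k) = 2 * \<i> * k"
proof -
  let ?a = "jcoef q k" and ?b = "jcoef q (- k)"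
  let ?c = "\<lambda>m. \<Sum>i\<le>m. (2 * k + of_nat i - of_nat (m - i)) * ?a i * ?b (m - i)"
  have s1: "(\<lambda>m. \<Sum>i\<le>m. (\<i> * (k + of_nat i) * ?a i) * ?b (m - i)) sums (jost_deriv q k * jost_value q (- k))"
    using Cauchy_product_sums[OF sums_jost(3)[OF k] summable_jcoef(1)[OF mk]]
    by (simp add: jost_value_def jost_deriv_def)
  have s2: "(\<lambda>m. \<Sum>i\<le>m. ?a i * (\<i> * (- k + of_nat (m - i)) * ?b (m - i))) sums (jost_value q k * jost_deriv q (- k))"
    using Cauchy_product_sums[OF summable_jcoef(1)[OF k] sums_jost(3)[OF mk]]
    by (simp add: jost_value_def jost_deriv_def)
  have "(\<lambda>m. \<i> * ?c m) sums (jost_deriv q k * jost_value q (- k) - jost_value q k * jost_deriv q (- k))"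
    using sums_diff[OF s1 s2]
    by (simp add: sum_subtractf [symmetric] sum_distrib_left algebra_simps)
  moreover have "?c m = (if m = 0 then 2 * k else 0)" for m
  proof (cases "m = 0")
    case False
    \<comment> \<open>With j = m - i, multiplication by m = i + j turns the weight into a difference
      of recursion factors: (i + j) (2 k + i - j) = i (i + 2 k) - j (j - 2 k). After
      \<open>jcoef_rec\<close> both parts are sums of products of q, \<open>?a\<close>,
      \<open>?b\<close> over the same index triples of total m, so they cancel.\<close>
    have "of_nat m * ?c m = (\<Sum>i\<le>m. of_nat m * ((2 * k + of_nat i - of_nat (m - i)) * ?a i * ?b (m - i)))"
      by (simp add: sum_distrib_left)
    also have "\<dots> = (\<Sum>i\<le>m. (of_nat i * (of_nat i + 2 * k) * ?a i) * ?b (m - i)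
       - ?a i * (of_nat (m - i) * (of_nat (m - i) + 2 * - k) * ?b (m - i)))"
      by (intro sum.cong refl) (simp add: of_nat_diff algebra_simps)
    also have "\<dots> = (\<Sum>i\<le>m. \<Sum>t<m-i. q (m - i - t) * ?a i * ?b t) - (\<Sum>i\<le>m. \<Sum>s<i. q (i - s) * ?a s * ?b (m - i))"
      unfolding jcoef_rec[OF k] jcoef_rec[OF mk]
      by (simp add: sum_subtractf sum_negf sum_distrib_left sum_distrib_right mult_ac)
    also have "(\<Sum>i\<le>m. \<Sum>s<i. q (i - s) * ?a s * ?b (m - i)) = (\<Sum>i\<le>m. \<Sum>t<m-i. q (m - i - t) * ?a i * ?b t)"
      unfolding sum.Sigma[OF finite_atMost ballI[OF finite_lessThan]]
      by (rule sum.reindex_bij_witness[of _ "\<lambda>(i, t). (m - t, i)" "\<lambda>(i, s). (s, m - i)"])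
        (auto simp: algebra_simps)
    finally show ?thesis using False by simp
  qed simp
  ultimately have "(\<lambda>m. if m = 0 then 2 * \<i> * k else 0) sums 
      (jost_deriv q k * jost_value q (- k) - jost_value q k * jost_deriv q (- k))"
    by (simp add: if_distrib[of "\<lambda>x. \<i> * x"] mult_ac cong: if_cong)
  moreover have "(\<lambda>m. if m = 0 then 2 * \<i> * k else 0) sums (2 * \<i> * k)"
    by (rule sums_single[of 0 "\<lambda>_. 2 * \<i> * k"])
  ultimately show ?thesis by (rule sums_unique2)
qed

text \<open>\<open>V_diag\<close> expresses n V q n n by q n and the numbers n V q m n with m < n,
  and n |V q m n| <= |V q m m| h(n - m) for a summable h with sum D. So a bound M on the earlier
  diagonal numbers yields n |V q n n| <= P + M D, which reproduces M for large n and then gives the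
  decay 1/n.\<close>

lemma norm_V_diag_le:
  obtains K where "K \<ge> 0" "\<And>n. 1 \<le> n \<Longrightarrow> norm (V q n n) \<le> K / real n"
proof -
  let ?B = "majorant (\<lambda>j. norm (q j)) 0 1"
  define h where "h = (\<lambda>j. real j * ?B j)"
  have B0: "?B j \<ge> 0" for j by (rule majorant_nonneg) auto
  have h0: "h j \<ge> 0" for j using B0 by (simp add: h_def)
  have hs: "summable h" unfolding h_def by (rule summable_mult_majorant_q) auto
  define D where "D = suminf h"
  have D0: "D \<ge> 0" unfolding D_def using hs h0 by (rule suminf_nonneg)
  obtain P where P: "\<And>n. norm (q n) \<le> P" "P > 0" using square_summable_bounded[OF square_summable] by metis
  have jB: "norm (jcoef q (of_nat m / 2) j) \<le> ?B j" for m j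
  proof -
    have "norm (1 * jcoef q (of_nat m / 2) j) \<le> ?B j"
      by (rule jcoef_le_majorant) (auto intro!: Re_gt_f1_dom Re_half_le_norm_of_nat_add[of "of_nat m / 2", simplified])
    then show ?thesis by simp
  qed
  \<comment> \<open>With j = n - m, the recursion factor at k = m/2 is j (j + m) = j n. The
    recursion of the majorant turns the right-hand side into j h(j) / 2, so cancelling j leaves the
    full weight n.\<close>
  have off: "real n * norm (V q m n) \<le> norm (V q m m) * h (n - m)" if "1 \<le> m" "m < n" for m n
  proof -
    define j where "j = n - m"
    have j: "n = m + j" "j > 0" using that by (auto simp: j_def)
    have k: "(of_nat m / 2 :: complex) \<in> f1_dom" by (rule Re_gt_f1_dom) auto
    have "real j * (real n * norm (jcoef q (of_nat m / 2) j)) 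
       = norm (of_nat j * (of_nat j + 2 * (of_nat m / 2)) * jcoef q (of_nat m / 2) j)"
      using j by (simp add: norm_mult add.commute flip: of_nat_add)
    also have "\<dots> = norm (\<Sum>s<j. q (j - s) * jcoef q (of_nat m / 2) s)"
      unfolding jcoef_rec[OF k] by (rule norm_minus_cancel)
    also have "\<dots> \<le> (\<Sum>s<j. norm (q (j - s)) * ?B s)"
      using jB by (intro order_trans[OF norm_sum] sum_mono) (auto simp: norm_mult intro!: mult_left_mono)
    also have "\<dots> = real j * (h j / 2)"
      using j by (simp add: h_def majorant.simps[of _ 0 1 j] power2_eq_square)
    finally have "real n * norm (jcoef q (of_nat m / 2) j) \<le> h j / 2" using j by simp
    also have "\<dots> \<le> h j" using h0[of j] by simp
    finally have "real n * norm (jcoef q (of_nat m / 2) j) \<le> h j" .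
    then have "norm (V q m m) * (real n * norm (jcoef q (of_nat m / 2) j)) \<le> norm (V q m m) * h j"
      by (intro mult_left_mono) auto
    moreover have "norm (V q m n) = norm (V q m m) * norm (jcoef q (of_nat m / 2) j)"
      using V_jcoef[OF that(1), of q j] j by (simp add: norm_mult)
    ultimately show ?thesis by (simp add: j_def mult_ac)
  qed
  have step: "real n * norm (V q n n) \<le> P + M * D"
    if n: "1 \<le> n" and M: "\<And>m. 1 \<le> m \<Longrightarrow> m < n \<Longrightarrow> norm (V q m m) \<le> M" "M \<ge> 0" for n M
  proof -
    have "{1..n} = insert n {1..<n}" using n by auto
    then have "of_nat n * V q n n + (\<Sum>m=1..<n. of_nat n * V q m n) + q n = 0"
      using V_diag[OF n, of q] by (simp add: distrib_left sum_distrib_left)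
    then have "of_nat n * V q n n = - q n - (\<Sum>m=1..<n. of_nat n * V q m n)"
      by (simp add: eq_diff_eq eq_neg_iff_add_eq_0)
    then have "real n * norm (V q n n) = norm (- q n - (\<Sum>m=1..<n. of_nat n * V q m n))"
      by (metis norm_mult norm_of_nat)
    also have "\<dots> \<le> norm (q n) + (\<Sum>m=1..<n. norm (of_nat n * V q m n))"
      by (intro order_trans[OF norm_triangle_ineq4] add_mono norm_sum) auto
    also have "\<dots> \<le> P + (\<Sum>m=1..<n. M * h (n - m))"
    proof (intro add_mono sum_mono P)
      fix m assume "m \<in> {1..<n}"
      then show "norm (of_nat n * V q m n) \<le> M * h (n - m)"
        using off[of m n] M(1)[of m] h0[of "n - m"] by (auto simp: norm_mult intro: order_trans mult_right_mono)
    qed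
    also have "(\<Sum>m=1..<n. M * h (n - m)) = M * (\<Sum>j=1..<n. h j)"
      unfolding sum_distrib_left
      by (rule sum.reindex_bij_witness[of _ "\<lambda>j. n - j" "\<lambda>j. n - j"]) auto
    also have "\<dots> \<le> M * D"
      unfolding D_def using h0 hs M(2) by (intro mult_left_mono sum_le_suminf) auto
    finally show ?thesis by simp
  qed
  \<comment> \<open>For n > N one has n >= D + 1, and M >= P then gives P + M D <= M (D + 1) <= M n.
    The remaining diagonal entries are built into \<open>M\<close>.\<close>
  define N where "N = nat \<lceil>D\<rceil> + 1"
  define M where "M = P + (\<Sum>n\<le>N. norm (V q n n))"
  have MP: "M \<ge> P" unfolding M_def by (simp add: sum_nonneg)
  have v: "norm (V q n n) \<le> M" for n
  proof (induction n rule: less_induct)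
    case (less n)
    show ?case
    proof (cases "n \<le> N")
      case True
      then have "norm (V q n n) \<le> (\<Sum>n\<le>N. norm (V q n n))" by (intro member_le_sum) auto
      then show ?thesis using P(2) by (simp add: M_def)
    next
      case False
      then have n: "real n \<ge> D + 1" "n \<ge> 1" unfolding N_def by linarith+
      have "real n * norm (V q n n) \<le> P + M * D"
        using less n MP P(2) by (intro step) auto
      also have "\<dots> \<le> M * (D + 1)" using MP by (simp add: algebra_simps)
      also have "\<dots> \<le> M * real n" using n MP P(2) by (intro mult_left_mono) auto
      finally show ?thesis using n by (simp add: mult.commute)
    qed
  qed
  show ?thesis
  proof (rule that[of "P + M * D"])
    show "P + M * D \<ge> 0" using P MP D0 by (intro add_nonneg_nonneg mult_nonneg_nonneg) auto
    show "norm (V q n n) \<le> (P + M * D) / real n" if "1 \<le> n" for n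
      using step[of n M] v MP P(2) that by (simp add: field_simps)
  qed
qed

end

section \<open>One-sided data of the Jost solutions\<close>

lemma norm_exp_i_of_nat [simp]: "norm (exp (\<i> * of_nat a * complex_of_real x)) = 1"
proof -
  have "\<i> * of_nat a * complex_of_real x = \<i> * of_real (real a * x)" by simp
  then show ?thesis by (metis norm_exp_i_times)
qed

lemma continuous_on_exp_series:
  fixes c :: "nat \<Rightarrow> complex"
  assumes "summable (\<lambda>a. norm (c a))"
  shows "continuous_on UNIV (\<lambda>x::real. \<Sum>a. c a * exp (\<i> * of_nat a * of_real x))"
proof (rule uniform_limit_theorem)
  show "uniform_limit UNIV (\<lambda>n x. \<Sum>a<n. c a * exp (\<i> * of_nat a * complex_of_real x))
      (\<lambda>x. \<Sum>a. c a * exp (\<i> * of_nat a * of_real x)) sequentially"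
    by (rule Weierstrass_m_test[OF _ assms]) (simp add: norm_mult)
qed (auto intro!: always_eventually continuous_intros)

lemma has_vector_derivative_exp_series:
  fixes c :: "nat \<Rightarrow> complex"
  assumes c: "summable (\<lambda>a. norm (c a))" and ac: "summable (\<lambda>a. real a * norm (c a))"
  shows "((\<lambda>x::real. \<Sum>a. c a * exp (\<i> * of_nat a * of_real x)) has_vector_derivative
     (\<Sum>a. \<i> * of_nat a * c a * exp (\<i> * of_nat a * of_real x))) (at x)"
proof -
  let ?f = "\<lambda>a (x::real). c a * exp (\<i> * of_nat a * of_real x)"
  let ?d = "\<lambda>a (x::real). \<i> * of_nat a * c a * exp (\<i> * of_nat a * of_real x)"
  let ?g = "\<lambda>x. \<Sum>a. ?d a x"
  have sum_f: "summable (\<lambda>a. ?f a x)" for x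
    by (rule summable_norm_cancel) (use c in \<open>simp add: norm_mult\<close>)
  have ul: "uniform_limit UNIV (\<lambda>n x. \<Sum>a<n. ?d a x) ?g sequentially"
    by (rule Weierstrass_m_test[OF _ ac]) (simp add: norm_mult)
  have "\<exists>g. \<forall>x\<in>UNIV. (\<lambda>a. ?f a x) sums g x \<and> (g has_derivative (\<lambda>h. h *\<^sub>R ?g x)) (at x within UNIV)"
  proof (rule has_derivative_series[where f' = "\<lambda>a x h. h *\<^sub>R ?d a x" and x = 0])
    show "(?f a has_derivative (\<lambda>h. h *\<^sub>R ?d a x)) (at x within UNIV)" for a x
      unfolding has_vector_derivative_def [symmetric]
      by (rule has_vector_derivative_real_field derivative_eq_intros refl | simp add: mult_ac)+
    show "(\<lambda>a. ?f a 0) sums (\<Sum>a. ?f a 0)" by (rule summable_sums[OF sum_f])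
    fix e :: real assume "e > 0"
    with ul have "\<forall>\<^sub>F n in sequentially. \<forall>x\<in>UNIV. dist (\<Sum>a<n. ?d a x) (?g x) < e"
      by (rule uniform_limitD)
    then show "\<forall>\<^sub>F n in sequentially. \<forall>x\<in>UNIV. \<forall>h. 
        norm ((\<Sum>a<n. h *\<^sub>R ?d a x) - h *\<^sub>R ?g x) \<le> e * norm h"
    proof (rule eventually_mono, intro ballI allI)
      fix n x and h :: real
      assume *: "\<forall>x\<in>UNIV. dist (\<Sum>a<n. ?d a x) (?g x) < e"
      have "(\<Sum>a<n. h *\<^sub>R ?d a x) - h *\<^sub>R ?g x = h *\<^sub>R ((\<Sum>a<n. ?d a x) - ?g x)"
        by (simp only: scaleR_right_diff_distrib scaleR_sum_right)
      then have "norm ((\<Sum>a<n. h *\<^sub>R ?d a x) - h *\<^sub>R ?g x) = \<bar>h\<bar> * dist (\<Sum>a<n. ?d a x) (?g x)"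
        by (simp only: norm_scaleR dist_norm)
      also have "\<dots> \<le> \<bar>h\<bar> * e" using * by (intro mult_left_mono) (auto intro: less_imp_le)
      finally show "norm ((\<Sum>a<n. h *\<^sub>R ?d a x) - h *\<^sub>R ?g x) \<le> e * norm h" by (simp add: mult.commute)
    qed
  qed auto
  then obtain g where g: "\<And>x. (\<lambda>a. ?f a x) sums g x" "\<And>x. (g has_derivative (\<lambda>h. h *\<^sub>R ?g x)) (at x)"
    by auto
  then have "g = (\<lambda>x. \<Sum>a. ?f a x)" by (auto intro: sums_unique)
  then show ?thesis using g(2)[of x] unfolding has_vector_derivative_def by simp
qed

context square_summable
begin

text \<open>By \<open>V_jcoef\<close>, row n is a multiple of the coefficient sequence at n/2, and
  all these points share one majorant. So \<open>D\<close> does not depend on n.\<close>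

lemma V_row_sum:
  obtains D where "D \<ge> 0" "\<And>n. 1 \<le> n \<Longrightarrow> summable (\<lambda>a. norm (V q n a))"
    "\<And>n. 1 \<le> n \<Longrightarrow> (\<Sum>a. norm (V q n a)) \<le> norm (V q n n) * D"
proof
  let ?B = "majorant (\<lambda>j. norm (q j)) 0 1"
  have B0: "?B j \<ge> 0" for j by (rule majorant_nonneg) auto
  have Bs: "summable ?B" by (rule summable_mult_majorant_q) auto
  show "suminf ?B \<ge> 0" using Bs B0 by (rule suminf_nonneg)
  fix n :: nat assume n: "1 \<le> n"
  have le: "norm (V q n (j + n)) \<le> norm (V q n n) * ?B j" for j
  proof -
    have "norm (1 * jcoef q (of_nat n / 2) j) \<le> ?B j"
      by (rule jcoef_le_majorant) (auto intro!: Re_gt_f1_dom Re_half_le_norm_of_nat_add[of "of_nat n / 2", simplified])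
    then show ?thesis using V_jcoef[OF n, of q j]
      by (auto simp: norm_mult add.commute intro!: mult_left_mono)
  qed
  have sB: "summable (\<lambda>j. norm (V q n n) * ?B j)" using Bs by (rule summable_mult)
  have s: "summable (\<lambda>j. norm (V q n (j + n)))"
    by (rule summable_comparison_test'[OF sB, where N = 0]) (use le in simp)
  then show sn: "summable (\<lambda>a. norm (V q n a))" by (rule summable_iff_shift[THEN iffD1])
  have "(\<Sum>a. norm (V q n a)) = (\<Sum>j. norm (V q n (j + n))) + (\<Sum>a<n. norm (V q n a))"
    by (rule suminf_split_initial_segment[OF sn])
  also have "(\<Sum>a<n. norm (V q n a)) = 0" by (simp add: V_eq_0)
  also have "(\<Sum>j. norm (V q n (j + n))) \<le> (\<Sum>j. norm (V q n n) * ?B j)"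
    by (rule suminf_le[OF le s sB])
  also have "\<dots> = norm (V q n n) * suminf ?B" using Bs by (rule suminf_mult)
  finally show "(\<Sum>a. norm (V q n a)) \<le> norm (V q n n) * suminf ?B" by simp
qed

text \<open>The Fubini condition for \<open>f1_plus_eq\<close>. Row n contributes at most |V q n n|
  D / |n + 2 k|, which is O(1/n^2) by \<open>norm_V_diag_le\<close>; bounded diagonal numbers would
  give only O(1/n).\<close>

lemma abs_summable_V:
  assumes k: "k \<in> f1_dom"
  shows "(\<lambda>p. norm (case p of (n, a) \<Rightarrow> V q n a / (of_nat n + 2 * k))) summable_on (UNIV \<times> UNIV)"
proof -
  obtain D where D: "D \<ge> 0" "\<And>n. 1 \<le> n \<Longrightarrow> summable (\<lambda>a. norm (V q n a))"
    "\<And>n. 1 \<le> n \<Longrightarrow> (\<Sum>a. norm (V q n a)) \<le> norm (V q n n) * D"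
    using V_row_sum by metis
  obtain K where K: "K \<ge> 0" "\<And>n. 1 \<le> n \<Longrightarrow> norm (V q n n) \<le> K / real n"
    using norm_V_diag_le by metis
  let ?w = "\<lambda>n. norm (of_nat n + 2 * k)"
  have sV: "summable (\<lambda>a. norm (V q n a))" for n
    using D(2)[of n] by (cases "n = 0") (auto simp: V_eq_0)
  have row: "((\<lambda>a. norm (V q n a / (of_nat n + 2 * k))) has_sum (\<Sum>a. norm (V q n a)) / ?w n) UNIV" for n
    using summable_sums[OF sV] unfolding norm_divide by (intro sums_nonneg_imp_has_sum sums_divide) auto
  define N where "N = nat \<lceil>4 * norm k\<rceil>"
  have s: "summable (\<lambda>n. (\<Sum>a. norm (V q n a)) / ?w n)"
  proof (rule summable_comparison_test'[where N = "Suc N" and g = "\<lambda>n. 2 * K * D * (1 / (real n)\<^sup>2)"])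
    show "summable (\<lambda>n. 2 * K * D * (1 / (real n)\<^sup>2))"
      using inverse_power_summable[of 2] by (intro summable_mult) (simp add: field_simps)
    fix n assume n: "n \<ge> Suc N"
    then have w: "real n / 2 \<le> ?w n"
      using half_le_norm_of_nat_add[OF order_refl, of k n] N_def by auto
    have "(\<Sum>a. norm (V q n a)) \<le> norm (V q n n) * D" using D(3)[of n] n by auto
    also have "\<dots> \<le> K / real n * D" using K(2)[of n] D(1) n by (intro mult_right_mono) auto
    finally have "(\<Sum>a. norm (V q n a)) / ?w n \<le> (K / real n * D) / (real n / 2)"
      using w n K D by (intro frac_le) auto
    also have "\<dots> = 2 * K * D * (1 / (real n)\<^sup>2)" by (simp add: power2_eq_square)
    finally show "norm ((\<Sum>a. norm (V q n a)) / ?w n) \<le> 2 * K * D * (1 / (real n)\<^sup>2)"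
      using suminf_nonneg[OF sV[of n]] by simp
  qed
  have "(\<lambda>n. (\<Sum>a. norm (V q n a)) / ?w n) summable_on UNIV"
    using s suminf_nonneg[OF sV] by (intro summable_nonneg_imp_summable_on) auto
  then show ?thesis
    unfolding Infinite_Sum.abs_summable_on_Sigma_iff using row[THEN infsumI] row[THEN has_sum_imp_summable]
      suminf_nonneg[OF sV]
    by auto
qed

lemma f1_plus_eq:
  assumes k: "k \<in> f1_dom"
  shows "f1_plus q k x = exp (\<i> * k * of_real x) * (\<Sum>a. jcoef q k a * exp (\<i> * of_nat a * of_real x))"
proof -
  let ?e = "\<lambda>a. exp (\<i> * of_nat a * complex_of_real x)"
  have "(\<Sum>\<^sub>\<infinity>n\<in>{1..}. 1 / (of_nat n + 2 * k) * (\<Sum>\<^sub>\<infinity>a\<in>{n..}. V q n a * ?e a)) =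
     (\<Sum>\<^sub>\<infinity>n. \<Sum>\<^sub>\<infinity>a. V q n a / (of_nat n + 2 * k) * ?e a)"
  proof (rule infsum_cong_neutral)
    fix n :: nat assume n: "n \<in> {1..} \<inter> UNIV"
    have "(\<Sum>\<^sub>\<infinity>a\<in>{n..}. V q n a * ?e a) = (\<Sum>\<^sub>\<infinity>a. V q n a * ?e a)"
      by (rule infsum_cong_neutral) (auto simp: V_eq_0)
    then show "1 / (of_nat n + 2 * k) * (\<Sum>\<^sub>\<infinity>a\<in>{n..}. V q n a * ?e a) =
      (\<Sum>\<^sub>\<infinity>a. V q n a / (of_nat n + 2 * k) * ?e a)"
      by (simp flip: infsum_cmult_right')
  qed (auto simp: V_eq_0)
  also have "\<dots> = (\<Sum>\<^sub>\<infinity>a. \<Sum>\<^sub>\<infinity>n. V q n a / (of_nat n + 2 * k) * ?e a)"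
  proof (rule infsum_swap_banach, rule abs_summable_summable, rule Infinite_Sum.abs_summable_on_comparison_test)
    show "norm (case p of (n, a) \<Rightarrow> V q n a / (of_nat n + 2 * k) * ?e a)
      \<le> norm (case p of (n, a) \<Rightarrow> V q n a / (of_nat n + 2 * k))" for p
      by (cases p) (simp add: norm_mult norm_divide)
  qed (rule abs_summable_V[OF k])
  also have "\<dots> = (\<Sum>\<^sub>\<infinity>a. if a = 0 then 0 else jcoef q k a * ?e a)"
  proof (rule infsum_cong)
    fix a :: nat
    have "(\<Sum>\<^sub>\<infinity>n. V q n a / (of_nat n + 2 * k) * ?e a) = (\<Sum>\<^sub>\<infinity>n\<in>{1..a}. V q n a / (of_nat n + 2 * k) * ?e a)"
      by (rule infsum_cong_neutral) (auto simp: V_eq_0 not_le)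
    then show "(\<Sum>\<^sub>\<infinity>n. V q n a / (of_nat n + 2 * k) * ?e a) = (if a = 0 then 0 else jcoef q k a * ?e a)"
      by (simp add: jcoef_def sum_distrib_right)
  qed
  \<comment> \<open>The index a = 0 carries nothing here since every \<open>V q n 0\<close> is 0;
    the missing term \<open>jcoef q k 0 = 1\<close> is the explicit 1 in
    \<open>f1_plus\<close>.\<close>
  also have "\<dots> = (\<Sum>a. jcoef q k a * ?e a) - 1"
  proof (rule infsumI, rule norm_summable_imp_has_sum)
    have n: "summable (\<lambda>a. norm (jcoef q k a * ?e a))" 
      using summable_jcoef[OF k] by (simp add: norm_mult)
    show "summable (\<lambda>a. norm (if a = 0 then 0 else jcoef q k a * ?e a))"
      by (rule summable_comparison_test'[OF n, where N = 0]) auto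
    have "(\<lambda>a. jcoef q k a * ?e a - (if a = 0 then 1 else 0)) sums ((\<Sum>a. jcoef q k a * ?e a) - 1)"
      by (intro sums_diff summable_sums summable_norm_cancel[OF n] sums_single[of 0 "\<lambda>_. 1", simplified])
    moreover have "(\<lambda>a. jcoef q k a * ?e a - (if a = 0 then 1 else 0)) = (\<lambda>a. if a = 0 then 0 else jcoef q k a * ?e a)"
      by auto
    ultimately show "(\<lambda>a. if a = 0 then 0 else jcoef q k a * ?e a) sums ((\<Sum>a. jcoef q k a * ?e a) - 1)"
      by simp
  qed
  finally show ?thesis by (simp add: f1_plus_def)
qed

text \<open>The series defines a continuously differentiable function on the whole line, so both
  one-sided limits are the values at 0. The left version serves \<open>f2_plus\<close>, which is
  \<open>f1_plus\<close> at another spectral point.\<close>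

lemma one_sided_data_f1_plus:
  assumes k: "k \<in> f1_dom"
  shows "right_data (f1_plus q k) = (jost_value q k, jost_deriv q k)"
    and "left_data (f1_plus q k) = (jost_value q k, jost_deriv q k)"
proof -
  define u where "u x = (\<Sum>a. jcoef q k a * exp (\<i> * of_nat a * complex_of_real x))" for x :: real
  define u' where "u' x = (\<Sum>a. \<i> * of_nat a * jcoef q k a * exp (\<i> * of_nat a * complex_of_real x))" for x :: real
  define w where "w x = \<i> * k * exp (\<i> * k * of_real x) * u x + exp (\<i> * k * of_real x) * u' x" for x :: real
  note s = summable_jcoef[OF k]
  have f: "f1_plus q k = (\<lambda>x. exp (\<i> * k * of_real x) * u x)"
    using f1_plus_eq[OF k] by (auto simp: u_def)
  have cu: "continuous_on UNIV u" unfolding u_def by (rule continuous_on_exp_series) (rule s)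
  have cu': "continuous_on UNIV u'" unfolding u'_def 
    by (rule continuous_on_exp_series) (use s in \<open>simp add: norm_mult\<close>)
  have du: "(u has_vector_derivative u' x) (at x)" for x
    unfolding u_def u'_def by (rule has_vector_derivative_exp_series[OF s])
  have de: "((\<lambda>x::real. exp (\<i> * k * of_real x)) has_vector_derivative \<i> * k * exp (\<i> * k * of_real x)) (at x)" for x
    by (rule has_vector_derivative_real_field derivative_eq_intros refl | simp add: mult_ac)+
  have "(f1_plus q k has_vector_derivative w x) (at x)" for x
    unfolding f w_def using has_vector_derivative_mult[OF de du, of x] by (simp add: add.commute)
  then have vw: "vderiv (f1_plus q k) = w" by (auto intro: vector_derivative_at)
  have "isCont (f1_plus q k) 0" "isCont w 0" 
    unfolding f w_def using cu cu' 
    by (auto intro!: continuous_intros simp: continuous_on_eq_continuous_at)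
  then have c: "(f1_plus q k \<longlongrightarrow> f1_plus q k 0) (at 0 within S)" "(w \<longlongrightarrow> w 0) (at 0 within S)" for S
    by (auto simp: isCont_def intro: tendsto_within_subset)
  have u0: "u 0 = jost_value q k" by (simp add: u_def jost_value_def)
  have sd: "summable (\<lambda>a. \<i> * of_nat a * jcoef q k a)" 
    by (rule summable_norm_cancel) (use s(2) in \<open>simp add: norm_mult\<close>)
  have sj: "summable (\<lambda>a. \<i> * k * jcoef q k a)" 
    by (intro summable_mult summable_norm_cancel[OF s(1)])
  have "w 0 = \<i> * k * (\<Sum>a. jcoef q k a) + (\<Sum>a. \<i> * of_nat a * jcoef q k a)" 
    by (simp add: w_def u_def u'_def)
  also have "\<dots> = jost_deriv q k"
    unfolding jost_deriv_def suminf_mult[OF summable_norm_cancel[OF s(1)], symmetric] suminf_add[OF sj sd]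
    by (simp add: algebra_simps)
  finally have w0: "w 0 = jost_deriv q k" .
  have f0: "f1_plus q k 0 = jost_value q k" by (simp add: f u0)
  show "right_data (f1_plus q k) = (jost_value q k, jost_deriv q k)"
     "left_data (f1_plus q k) = (jost_value q k, jost_deriv q k)"
    using c unfolding right_data_def left_data_def vw
    by (auto simp: f0 w0 intro!: tendsto_Lim)
qed

end

section \<open>Dependence on the spectral parameter\<close>

text \<open>Separating this from \<open>jost_deriv\<close> leaves series whose weights do not depend
  on k, as \<open>holomorphic_weighted_series\<close> and \<open>tendsto_weighted_series\<close>
  require.\<close>

definition jost_moment :: "(nat \<Rightarrow> complex) \<Rightarrow> complex \<Rightarrow> complex" where
  "jost_moment q k = (\<Sum>a. of_nat a * jcoef q k a)"

context square_summable
begin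

lemma summable_jost_moment:
  assumes k: "k \<in> f1_dom"
  shows "summable (\<lambda>a. of_nat a * jcoef q k a)"
  by (rule summable_norm_cancel) (use summable_jcoef(2)[OF k] in \<open>simp add: norm_mult\<close>)

lemma jost_deriv_eq:
  assumes k: "k \<in> f1_dom"
  shows "jost_deriv q k = \<i> * (k * jost_value q k + jost_moment q k)"
proof -
  note s1 = summable_norm_cancel[OF summable_jcoef(1)[OF k]] and s2 = summable_jost_moment[OF k]
  have "jost_deriv q k = (\<Sum>a. \<i> * (k * jcoef q k a + of_nat a * jcoef q k a))"
    unfolding jost_deriv_def by (simp add: algebra_simps)
  also have "\<dots> = \<i> * (\<Sum>a. k * jcoef q k a + of_nat a * jcoef q k a)"
    by (intro suminf_mult summable_add summable_mult s1 s2)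
  also have "(\<Sum>a. k * jcoef q k a + of_nat a * jcoef q k a) = k * jost_value q k + jost_moment q k"
    unfolding jost_value_def jost_moment_def suminf_mult[OF s1, symmetric]
    by (rule suminf_add[symmetric]) (intro summable_mult s1 s2)+
  finally show ?thesis .
qed

lemma holomorphic_weighted_series:
  fixes w :: "nat \<Rightarrow> complex"
  assumes w: "\<And>a. norm (w a) \<le> real a + 1"
  shows "(\<lambda>k. \<Sum>a. w a * jcoef q k a) holomorphic_on {k. Re k > - 1 / 4}"
proof (rule holomorphic_uniform_sequence)
  let ?R = "{k. Re k > - 1 / 4}" and ?B = "majorant (\<lambda>j. norm (q j)) 0 1"
  have dom: "k \<in> f1_dom" if "k \<in> ?R" for k using that by (auto intro: Re_gt_f1_dom)
  show op: "open ?R" by (rule open_halfspace_Re_gt)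
  have "(\<lambda>k. jcoef q k a) holomorphic_on ?R" for a
  proof (cases "a = 0")
    case False
    have "(\<lambda>k. \<Sum>n=1..a. V q n a / (of_nat n + 2 * k)) holomorphic_on ?R"
      by (intro holomorphic_intros) (use dom in \<open>auto simp: f1_dom_def\<close>)
    then show ?thesis using False by (simp add: jcoef_def)
  qed simp
  then show "(\<lambda>k. \<Sum>a<n. w a * jcoef q k a) holomorphic_on ?R" for n
    by (intro holomorphic_intros)
  have "summable (\<lambda>a. real a * ?B a + ?B a)" 
    by (intro summable_add summable_mult_majorant_q) auto
  then have sB: "summable (\<lambda>a. (real a + 1) * ?B a)" by (simp add: algebra_simps)
  have ul: "uniform_limit ?R (\<lambda>n k. \<Sum>a<n. w a * jcoef q k a) (\<lambda>k. \<Sum>a. w a * jcoef q k a) sequentially"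
  proof (rule Weierstrass_m_test[OF _ sB])
    fix a k assume k: "k \<in> ?R"
    have "norm (1 * jcoef q k a) \<le> ?B a"
      using k by (intro jcoef_le_majorant Re_half_le_norm_of_nat_add dom) auto
    then show "norm (w a * jcoef q k a) \<le> (real a + 1) * ?B a"
      using w[of a] unfolding norm_mult by (intro mult_mono) auto
  qed
  fix x assume "x \<in> ?R"
  then obtain d where "d > 0" "cball x d \<subseteq> ?R" using op open_contains_cball by blast
  then show "\<exists>d>0. cball x d \<subseteq> ?R \<and> uniform_limit (cball x d) (\<lambda>n k. \<Sum>a<n. w a * jcoef q k a)
      (\<lambda>k. \<Sum>a. w a * jcoef q k a) sequentially"
    using uniform_limit_on_subset[OF ul] by blast
qed

lemma holomorphic_jost:
  "jost_value q holomorphic_on {k. Re k > - 1 / 4}" (is "_ holomorphic_on ?R")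
  "jost_deriv q holomorphic_on {k. Re k > - 1 / 4}"
proof -
  show 1: "jost_value q holomorphic_on ?R"
    using holomorphic_weighted_series[of "\<lambda>_. 1"] by (simp add: jost_value_def[abs_def])
  have 2: "jost_moment q holomorphic_on ?R"
    using holomorphic_weighted_series[of of_nat] by (simp add: jost_moment_def[abs_def])
  have "(\<lambda>k. \<i> * (k * jost_value q k + jost_moment q k)) holomorphic_on ?R"
    by (intro holomorphic_intros 1 2)
  then show "jost_deriv q holomorphic_on ?R"
    by (rule holomorphic_transform) (auto intro!: jost_deriv_eq[symmetric] Re_gt_f1_dom)
qed

lemma isCont_jost:
  assumes "Re k > - 1 / 4"
  shows "isCont (jost_value q) k" "isCont (jost_deriv q) k"
  using holomorphic_jost[THEN holomorphic_on_imp_continuous_on] assms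
  by (auto simp: continuous_on_eq_continuous_at open_halfspace_Re_gt)

text \<open>Tannery's theorem. Along \<open>F\<close> the first N + 1 terms are eventually below 1
  plus the sum of the norms of their limits, and the recursion then bounds all later terms by one
  majorant. Only termwise limits remain to be computed.\<close>

lemma tendsto_weighted_series:
  fixes w :: "nat \<Rightarrow> complex" and c k :: "'b \<Rightarrow> complex"
  assumes w: "\<And>a. norm (w a) \<le> real a + 1" and F: "F \<noteq> bot"
    and dom: "eventually (\<lambda>x. k x \<in> f1_dom) F"
    and far: "eventually (\<lambda>x. \<forall>a>N. real a / 2 \<le> norm (of_nat a + 2 * k x)) F"
    and lim: "\<And>a. ((\<lambda>x. c x * jcoef q (k x) a) \<longlongrightarrow> l a) F"
  shows "((\<lambda>x. c x * (\<Sum>a. w a * jcoef q (k x) a)) \<longlongrightarrow> (\<Sum>a. w a * l a)) F"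
proof -
  define M where "M = 1 + (\<Sum>a\<le>N. norm (l a))"
  have M0: "M \<ge> 0" unfolding M_def by (intro add_nonneg_nonneg sum_nonneg) auto
  let ?B = "majorant (\<lambda>j. norm (q j)) N M"
  have "eventually (\<lambda>x. \<forall>a\<in>{..N}. norm (c x * jcoef q (k x) a) < M) F"
  proof (rule eventually_ball_finite, simp, rule ballI)
    fix a assume "a \<in> {..N}"
    then have "norm (l a) \<le> (\<Sum>a\<le>N. norm (l a))" by (intro member_le_sum) auto
    then have "norm (l a) < M" by (simp add: M_def)
    then show "eventually (\<lambda>x. norm (c x * jcoef q (k x) a) < M) F"
      using tendsto_norm[OF lim] by (rule order_tendstoD(2)[rotated])
  qed
  then have "eventually (\<lambda>x. \<forall>a. norm (w a * (c x * jcoef q (k x) a)) \<le> (real a + 1) * ?B a) F"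
    using dom far
  proof eventually_elim
    case (elim x)
    then have "norm (c x * jcoef q (k x) a) \<le> ?B a" for a
      by (intro jcoef_le_majorant) (auto intro: less_imp_le)
    then show ?case
      using w unfolding norm_mult[of "w _"] by (intro allI mult_mono) auto
  qed
  then have bound: "eventually (\<lambda>(a, x). norm (w a * (c x * jcoef q (k x) a)) \<le> (real a + 1) * ?B a) (at_top \<times>\<^sub>F F)"
    unfolding eventually_prod_filter by (intro exI[of _ "\<lambda>_. True"] exI conjI) auto
  have "summable (\<lambda>a. real a * ?B a + ?B a)" 
    using M0 by (intro summable_add summable_mult_majorant_q) auto
  then have sB: "summable (\<lambda>a. (real a + 1) * ?B a)" by (simp add: algebra_simps)
  have "((\<lambda>x. \<Sum>a. w a * (c x * jcoef q (k x) a)) \<longlongrightarrow> (\<Sum>a. w a * l a)) F"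
    using tannerys_theorem[OF tendsto_mult[OF tendsto_const lim] bound sB F] by blast
  moreover have "eventually (\<lambda>x. (\<Sum>a. w a * (c x * jcoef q (k x) a)) = c x * (\<Sum>a. w a * jcoef q (k x) a)) F"
    using dom
  proof eventually_elim
    case (elim x)
    have "summable (\<lambda>a. real a * norm (jcoef q (k x) a) + norm (jcoef q (k x) a))"
      by (intro summable_add summable_jcoef elim)
    then have s: "summable (\<lambda>a. (real a + 1) * norm (jcoef q (k x) a))" by (simp add: algebra_simps)
    have "summable (\<lambda>a. w a * jcoef q (k x) a)"
      by (rule summable_comparison_test'[OF s, where N = 0]) (auto simp: norm_mult intro!: mult_right_mono w)
    then show ?case by (subst suminf_mult[symmetric]) (simp_all add: mult_ac)
  qed
  ultimately show ?thesis by (rule Lim_transform_eventually)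
qed

text \<open>In the limit the factor n + 2 k kills every summand of \<open>jcoef\<close> except the
  n-th, so the a-th coefficient tends to \<open>V q n a\<close> and the limit series is row n of
  \<open>V\<close>, evaluated by \<open>V_jcoef\<close>. In the derivative, a = n + j and k + a
  tends to n/2 + j, the weight of \<open>jost_deriv\<close> at n/2.\<close>

lemma jost_residue:
  assumes n: "1 \<le> n" and F: "F \<noteq> bot"
    and k: "(k \<longlongrightarrow> - (of_nat n / 2)) F" and dom: "eventually (\<lambda>x. k x \<in> f1_dom) F"
  shows "((\<lambda>x. (of_nat n + 2 * k x) * jost_value q (k x)) \<longlongrightarrow> V q n n * jost_value q (of_nat n / 2)) F"
    and "((\<lambda>x. (of_nat n + 2 * k x) * jost_deriv q (k x)) \<longlongrightarrow> V q n n * jost_deriv q (of_nat n / 2)) F"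
proof -
  let ?c = "\<lambda>x. of_nat n + 2 * k x" and ?h = "of_nat n / 2 :: complex"
  have h: "?h \<in> f1_dom" by (rule Re_gt_f1_dom) auto
  define r where "r = real n / 2 + 1"
  have "eventually (\<lambda>x. norm (k x) < r) F"
    using tendsto_norm[OF k] by (rule order_tendstoD) (simp add: r_def norm_divide)
  then have far: "eventually (\<lambda>x. \<forall>a>nat \<lceil>4 * r\<rceil>. real a / 2 \<le> norm (of_nat a + 2 * k x)) F"
    by eventually_elim (use half_le_norm_of_nat_add less_imp_le in blast)
  have c0: "(?c \<longlongrightarrow> 0) F" using tendsto_add[OF tendsto_const tendsto_mult[OF tendsto_const k], of "of_nat n" 2] by simp
  have lim: "((\<lambda>x. ?c x * jcoef q (k x) a) \<longlongrightarrow> V q n a) F" for a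
  proof (cases "a = 0")
    case True
    then show ?thesis using c0 n by (simp add: V_eq_0)
  next
    case False
    have "((\<lambda>x. \<Sum>m=1..a. ?c x * (V q m a / (of_nat m + 2 * k x))) \<longlongrightarrow> (\<Sum>m=1..a. if m = n then V q n a else 0)) F"
    proof (rule tendsto_sum)
      fix m assume m: "m \<in> {1..a}"
      show "((\<lambda>x. ?c x * (V q m a / (of_nat m + 2 * k x))) \<longlongrightarrow> (if m = n then V q n a else 0)) F"
      proof (cases "m = n")
        case True
        have "eventually (\<lambda>x. V q n a = ?c x * (V q m a / (of_nat m + 2 * k x))) F"
          using dom by eventually_elim (use True n in \<open>auto simp: f1_dom_def\<close>)
        then show ?thesis using True by (auto intro: Lim_transform_eventually)
      next
        case False
        then have "of_nat m + 2 * - ?h \<noteq> (0::complex)" by simp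
        from tendsto_mult[OF c0 tendsto_divide[OF tendsto_const tendsto_add[OF tendsto_const tendsto_mult[OF tendsto_const k]] this]]
        show ?thesis using False by simp
      qed
    qed
    moreover have "(\<Sum>m=1..a. if m = n then V q n a else 0) = V q n a"
      using n by (auto simp: V_eq_0)
    ultimately show ?thesis using False by (simp add: jcoef_def sum_distrib_left)
  qed
  note T = tendsto_weighted_series[OF _ F dom far lim]
  note s1 = summable_norm_cancel[OF summable_jcoef(1)[OF h]] and s2 = summable_jost_moment[OF h]
  have V: "V q n (j + n) = V q n n * jcoef q ?h j" for j
    using V_jcoef[OF n, of q j] by (simp add: add.commute)
  have "(\<lambda>j. V q n (j + n)) sums (V q n n * jost_value q ?h)"
    unfolding V jost_value_def by (intro sums_mult summable_sums s1)
  then have "(\<lambda>a. V q n a) sums (V q n n * jost_value q ?h)"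
    by (subst (asm) sums_iff_shift) (simp add: V_eq_0)
  then show 1: "((\<lambda>x. ?c x * jost_value q (k x)) \<longlongrightarrow> V q n n * jost_value q ?h) F"
    using T[of "\<lambda>_. 1"] by (simp add: jost_value_def sums_iff)
  have "(\<lambda>j. V q n n * (of_nat j * jcoef q ?h j + of_nat n * jcoef q ?h j))
      sums (V q n n * (jost_moment q ?h + of_nat n * jost_value q ?h))"
    unfolding jost_value_def jost_moment_def by (intro sums_mult sums_add summable_sums s1 s2)
  then have "(\<lambda>j. of_nat (j + n) * V q n (j + n)) sums (V q n n * (jost_moment q ?h + of_nat n * jost_value q ?h))"
    unfolding V by (simp add: algebra_simps)
  then have "(\<lambda>a. of_nat a * V q n a) sums (V q n n * (jost_moment q ?h + of_nat n * jost_value q ?h))"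
    by (subst (asm) sums_iff_shift) (simp add: V_eq_0)
  then have 2: "((\<lambda>x. ?c x * jost_moment q (k x)) \<longlongrightarrow> V q n n * (jost_moment q ?h + of_nat n * jost_value q ?h)) F"
    using T[of of_nat] by (simp add: jost_moment_def sums_iff)
  have lim': "((\<lambda>x. \<i> * (k x * (?c x * jost_value q (k x)) + ?c x * jost_moment q (k x))) \<longlongrightarrow>
     \<i> * (- ?h * (V q n n * jost_value q ?h) + V q n n * (jost_moment q ?h + of_nat n * jost_value q ?h))) F"
    by (intro tendsto_intros k 1 2)
  have val: "\<i> * (- ?h * (V q n n * jost_value q ?h) + V q n n * (jost_moment q ?h + of_nat n * jost_value q ?h))
     = V q n n * jost_deriv q ?h"
    unfolding jost_deriv_eq[OF h] by (simp add: field_simps)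
  have "eventually (\<lambda>x. \<i> * (k x * (?c x * jost_value q (k x)) + ?c x * jost_moment q (k x))
     = ?c x * jost_deriv q (k x)) F"
    using dom by eventually_elim (simp add: jost_deriv_eq algebra_simps)
  then show "((\<lambda>x. ?c x * jost_deriv q (k x)) \<longlongrightarrow> V q n n * jost_deriv q ?h) F"
    by (rule Lim_transform_eventually[OF lim'[unfolded val]])
qed

text \<open>Every coefficient with a >= 1 tends to 0, which leaves the term a = 0. The boundary of
  the half-plane is included because C11 on the positive imaginary axis involves \<kappa> = -
  i.\<close>

lemma jost_asymptotics:
  assumes \<kappa>: "\<kappa> \<noteq> 0" "Re \<kappa> \<ge> 0"
  shows "((\<lambda>R. jost_value q (of_real R * \<kappa>)) \<longlongrightarrow> 1) at_top"
    and "((\<lambda>R. jost_deriv q (of_real R * \<kappa>) / of_real R) \<longlongrightarrow> \<i> * \<kappa>) at_top"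
proof -
  have ev: "eventually (\<lambda>R::real. R > 0) at_top" by (rule eventually_gt_at_top)
  have Re: "Re (of_real R * \<kappa>) \<ge> 0" if "R > 0" for R :: real using that \<kappa> by simp
  have dom: "eventually (\<lambda>R::real. of_real R * \<kappa> \<in> f1_dom) at_top"
    using ev by eventually_elim (use Re in \<open>force intro: Re_gt_f1_dom\<close>)
  have far: "eventually (\<lambda>R::real. \<forall>a>0. real a / 2 \<le> norm (of_nat a + 2 * (of_real R * \<kappa>))) at_top"
    using ev
  proof eventually_elim
    case (elim R)
    then show ?case using Re[of R] by (intro allI impI Re_half_le_norm_of_nat_add) linarith+
  qed
  have "filterlim (\<lambda>R::real. \<kappa> * of_real R) at_infinity at_top"
    by (rule tendsto_mult_filterlim_at_infinity[OF tendsto_const \<kappa>(1) filterlim_of_real_at_infinity])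
  then have inf: "filterlim (\<lambda>R::real. of_real R * \<kappa>) at_infinity at_top"
    by (simp add: mult.commute)
  have lim: "((\<lambda>R::real. 1 * jcoef q (of_real R * \<kappa>) a) \<longlongrightarrow> (if a = 0 then 1 else 0)) at_top" for a
  proof (cases "a = 0")
    case False
    have "((\<lambda>R::real. V q n a / (of_nat n + 2 * (of_real R * \<kappa>))) \<longlongrightarrow> 0) at_top" for n
      by (rule tendsto_divide_0[OF tendsto_const])
        (intro tendsto_add_filterlim_at_infinity[OF tendsto_const] 
          tendsto_mult_filterlim_at_infinity[OF tendsto_const] inf, simp)
    then have "((\<lambda>R::real. \<Sum>n=1..a. V q n a / (of_nat n + 2 * (of_real R * \<kappa>))) \<longlongrightarrow> 0) at_top"
      by (intro tendsto_null_sum)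
    then show ?thesis using False by (simp add: jcoef_def)
  qed simp
  note T = tendsto_weighted_series[OF _ _ dom far lim]
  have s: "(\<Sum>a. w a * (if a = 0 then 1 else 0)) = w 0" for w :: "nat \<Rightarrow> complex"
    using sums_single[of 0 w] by (simp add: sums_iff if_distrib cong: if_cong)
  show 1: "((\<lambda>R. jost_value q (of_real R * \<kappa>)) \<longlongrightarrow> 1) at_top"
    using T[of "\<lambda>_. 1"] s[of "\<lambda>_. 1"] by (simp add: jost_value_def)
  have 2: "((\<lambda>R. jost_moment q (of_real R * \<kappa>)) \<longlongrightarrow> 0) at_top"
    using T[of of_nat] s[of of_nat] by (simp add: jost_moment_def)
  have "((\<lambda>R. \<i> * (\<kappa> * jost_value q (of_real R * \<kappa>) + jost_moment q (of_real R * \<kappa>) / of_real R)) \<longlongrightarrow>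
    \<i> * (\<kappa> * 1 + 0)) at_top"
    by (intro tendsto_intros 1 tendsto_divide_0[OF 2] filterlim_of_real_at_infinity)
  then have lim': "((\<lambda>R. \<i> * (\<kappa> * jost_value q (of_real R * \<kappa>) + jost_moment q (of_real R * \<kappa>) / of_real R)) \<longlongrightarrow>
    \<i> * \<kappa>) at_top" by simp
  have "eventually (\<lambda>R. \<i> * (\<kappa> * jost_value q (of_real R * \<kappa>) + jost_moment q (of_real R * \<kappa>) / of_real R)
     = jost_deriv q (of_real R * \<kappa>) / of_real R) at_top"
    using dom ev by eventually_elim (simp add: jost_deriv_eq field_simps)
  then show "((\<lambda>R. jost_deriv q (of_real R * \<kappa>) / of_real R) \<longlongrightarrow> \<i> * \<kappa>) at_top"
    by (rule Lim_transform_eventually[OF lim'])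
qed

end

section \<open>Recovering the potential\<close>

text \<open>The poles - m/2 are spaced by 1/2, so this approach to - n/2 from the right meets none
  of them.\<close>

lemma half_integer_shift_dom:
  assumes "0 < t" "t < 1 / 2"
  shows "- (of_nat n / 2) + of_real t \<in> f1_dom"
proof -
  have "of_nat m + 2 * (- (of_nat n / 2) + of_real t) \<noteq> (0 :: complex)" for m
  proof
    assume "of_nat m + 2 * (- (of_nat n / 2) + of_real t) = (0 :: complex)"
    then have "Re (of_nat m + 2 * (- (of_nat n / 2) + of_real t)) = 0" by (simp only: zero_complex.sel)
    then have "real n - real m = 2 * t" by simp
    then have "0 < int n - int m" "int n - int m < 1" using assms by linarith+
    then show False by simp
  qed
  then show ?thesis by (auto simp: f1_dom_def)
qed

lemma f2_plus_eq_f1_plus: "f2_plus q \<beta> z = f1_plus q (- \<i> * of_real \<beta> * z)"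
  by (rule ext) (simp add: f2_plus_def f1_plus_def mult_ac)

lemma f2_dom_iff: "z \<in> f2_dom \<beta> \<longleftrightarrow> - \<i> * of_real \<beta> * z \<in> f1_dom"
  by (simp add: f2_dom_def f1_dom_def mult_ac)

lemma imaginary_f2_dom:
  assumes "R > 0" "\<beta> > 0"
  shows "\<i> * of_real R \<in> f2_dom \<beta>"
  unfolding f2_dom_iff using assms
  by (intro Re_gt_f1_dom) (simp add: order_less_le_trans[of _ 0])

lemma imaginary_C11_dom: "R > 0 \<Longrightarrow> \<beta> > 0 \<Longrightarrow> \<i> * of_real R \<in> C11_dom \<beta>"
  unfolding C11_dom_def by (auto intro!: imaginary_f2_dom Re_gt_f1_dom)

lemma imaginary_C12_dom: "R > 0 \<Longrightarrow> \<beta> > 0 \<Longrightarrow> \<i> * of_real R \<in> C12_dom \<beta>"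
  unfolding C12_dom_def by (auto intro!: imaginary_f2_dom Re_gt_f1_dom)

context square_summable
begin

text \<open>
  If both vanished at n/2, the poles at - n/2 would have residue 0 and the left-hand side of
  jost_wronskian would tend to 0 at - n/2, but the right-hand side tends to - i n.
\<close>

lemma jost_nonzero:
  assumes n: "1 \<le> n"
  shows "jost_value q (of_nat n / 2) \<noteq> 0 \<or> jost_deriv q (of_nat n / 2) \<noteq> 0"
proof (rule ccontr)
  let ?h = "of_nat n / 2 :: complex"
  assume "\<not> ?thesis"
  then have z: "jost_value q ?h = 0" "jost_deriv q ?h = 0" by auto
  let ?F = "at_right (0::real)" and ?k = "\<lambda>t. - ?h + of_real t"
  have ev: "eventually (\<lambda>t::real. 0 < t \<and> t < 1 / 2) ?F"
    using eventually_at_right_real[of 0 "1 / 2"] by simp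
  have dom: "eventually (\<lambda>t. ?k t \<in> f1_dom) ?F"
    using ev by eventually_elim (rule half_integer_shift_dom, auto)
  have mdom: "eventually (\<lambda>t. - ?k t \<in> f1_dom) ?F"
    using ev by eventually_elim (rule Re_gt_f1_dom, auto)
  have t0: "((\<lambda>t::real. - complex_of_real t) \<longlongrightarrow> 0) ?F"
    by (auto intro!: tendsto_eq_intros)
  have fl: "filterlim (\<lambda>t::real. - complex_of_real t) (at 0) ?F"
    unfolding filterlim_at using t0 ev by (auto elim: eventually_mono)
  have k: "(?k \<longlongrightarrow> - ?h) ?F" by (auto intro!: tendsto_eq_intros)
  \<comment> \<open>\<open>- ?k t\<close> is n/2 - t, and data vanishing at n/2 vanish there at
    least to first order, so the quotients by - t converge. The compensating factor t goes to the
    terms at \<open>?k t\<close>, which it turns into residues.\<close>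
  have quot: "\<exists>L. ((\<lambda>t. f (- ?k t) / - of_real t) \<longlongrightarrow> L) ?F"
    if hol: "f holomorphic_on {k. Re k > - 1 / 4}" and "f ?h = 0" for f
  proof -
    obtain L where "(f has_field_derivative L) (at ?h)"
      using holomorphic_on_imp_differentiable_at[OF hol open_halfspace_Re_gt, of ?h]
      by (auto simp: field_differentiable_def)
    then have "((\<lambda>s. (f (?h + s) - f ?h) / s) \<longlongrightarrow> L) (at 0)" by (simp add: DERIV_def)
    from filterlim_compose[OF this fl] that(2) show ?thesis by (auto simp: algebra_simps)
  qed
  obtain L1 L2 where L: "((\<lambda>t. jost_value q (- ?k t) / - of_real t) \<longlongrightarrow> L1) ?F"
      "((\<lambda>t. jost_deriv q (- ?k t) / - of_real t) \<longlongrightarrow> L2) ?F"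
    using quot[OF holomorphic_jost(1) z(1)] quot[OF holomorphic_jost(2) z(2)] by blast
  have c: "of_nat n + 2 * ?k t = 2 * of_real t" for t by simp
  have res: "((\<lambda>t. 2 * of_real t * jost_value q (?k t)) \<longlongrightarrow> 0) ?F"
       "((\<lambda>t. 2 * of_real t * jost_deriv q (?k t)) \<longlongrightarrow> 0) ?F"
    using jost_residue[OF n _ k dom] unfolding c z by simp_all
  have "((\<lambda>t. 2 * of_real t * jost_deriv q (?k t) * (jost_value q (- ?k t) / - of_real t)
     - 2 * of_real t * jost_value q (?k t) * (jost_deriv q (- ?k t) / - of_real t)) \<longlongrightarrow> 0 * L1 - 0 * L2) ?F"
    by (intro tendsto_diff tendsto_mult[OF res(2) L(1)] tendsto_mult[OF res(1) L(2)])
  moreover have "eventually (\<lambda>t. 2 * of_real t * jost_deriv q (?k t) * (jost_value q (- ?k t) / - of_real t)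
     - 2 * of_real t * jost_value q (?k t) * (jost_deriv q (- ?k t) / - of_real t) = - 4 * \<i> * ?k t) ?F"
    using ev dom mdom
  proof eventually_elim
    case (elim t)
    have "2 * of_real t * jost_deriv q (?k t) * (jost_value q (- ?k t) / - of_real t)
     - 2 * of_real t * jost_value q (?k t) * (jost_deriv q (- ?k t) / - of_real t) =
      - 2 * (jost_deriv q (?k t) * jost_value q (- ?k t) - jost_value q (?k t) * jost_deriv q (- ?k t))"
      using elim(1) by (simp add: field_simps)
    then show ?case unfolding jost_wronskian[OF elim(2,3)] by simp
  qed
  ultimately have "((\<lambda>t. - 4 * \<i> * ?k t) \<longlongrightarrow> 0) ?F"
    by (auto intro: Lim_transform_eventually)
  moreover have "((\<lambda>t. - 4 * \<i> * ?k t) \<longlongrightarrow> - 4 * \<i> * - ?h) ?F"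
    by (intro tendsto_intros k)
  ultimately have "- 4 * \<i> * - ?h = 0"
    using tendsto_unique[OF trivial_limit_at_right_real] by blast
  then show False using n by simp
qed

section \<open>C11 and C12 as Wronskians of Jost data\<close>

lemma C11_eq:
  assumes "z \<in> C11_dom \<beta>"
  shows "2 * \<i> * z * C11 q \<beta> z = jost_deriv q (- \<i> * of_real \<beta> * z) * jost_value q (- z)
     - jost_value q (- \<i> * of_real \<beta> * z) * jost_deriv q (- z)"
proof -
  have 1: "- \<i> * of_real \<beta> * z \<in> f1_dom" "- z \<in> f1_dom" "z \<noteq> 0"
    using assms by (auto simp: C11_dom_def f2_dom_iff)
  then show ?thesis
    by (simp add: C11_def f2_plus_eq_f1_plus f1_minus_def one_sided_data_f1_plus wronskian_def)
qed

lemma C12_eq: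
  assumes "z \<in> C12_dom \<beta>"
  shows "2 * \<i> * z * C12 q \<beta> z = jost_deriv q z * jost_value q (- \<i> * of_real \<beta> * z)
     - jost_value q z * jost_deriv q (- \<i> * of_real \<beta> * z)"
proof -
  have 1: "- \<i> * of_real \<beta> * z \<in> f1_dom" "z \<in> f1_dom" "z \<noteq> 0"
    using assms by (auto simp: C12_dom_def f2_dom_iff)
  then show ?thesis
    by (simp add: C12_def f2_plus_eq_f1_plus one_sided_data_f1_plus wronskian_def)
qed

lemma C11_asymptotics:
  assumes \<beta>: "\<beta> > 0"
  shows "((\<lambda>R. C11 q \<beta> (\<i> * of_real R)) \<longlongrightarrow> (1 - \<i> * of_real \<beta>) / 2) at_top"
proof -
  have a: "((\<lambda>R. jost_value q (of_real R * of_real \<beta>)) \<longlongrightarrow> 1) at_top"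
    "((\<lambda>R. jost_deriv q (of_real R * of_real \<beta>) / of_real R) \<longlongrightarrow> \<i> * of_real \<beta>) at_top"
    using jost_asymptotics[of "of_real \<beta>"] \<beta> by simp_all
  have b: "((\<lambda>R. jost_value q (of_real R * - \<i>)) \<longlongrightarrow> 1) at_top"
    "((\<lambda>R. jost_deriv q (of_real R * - \<i>) / of_real R) \<longlongrightarrow> \<i> * - \<i>) at_top"
    using jost_asymptotics[of "- \<i>"] by simp_all
  \<comment> \<open>At z = i R the denominator 2 i z is - 2 R: the R goes into the derivatives, the
    - 2 stays.\<close>
  have "((\<lambda>R. (jost_deriv q (of_real R * of_real \<beta>) / of_real R * jost_value q (of_real R * - \<i>)
      - jost_value q (of_real R * of_real \<beta>) * (jost_deriv q (of_real R * - \<i>) / of_real R)) / - 2) \<longlongrightarrow>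
    (\<i> * of_real \<beta> * 1 - 1 * (\<i> * - \<i>)) / - 2) at_top"
    by (intro tendsto_intros a b) simp
  moreover have "(\<i> * of_real \<beta> * 1 - 1 * (\<i> * - \<i>)) / - 2 = (1 - \<i> * of_real \<beta>) / 2"
    by (simp add: field_simps)
  ultimately have lim: "((\<lambda>R. (jost_deriv q (of_real R * of_real \<beta>) / of_real R * jost_value q (of_real R * - \<i>)
      - jost_value q (of_real R * of_real \<beta>) * (jost_deriv q (of_real R * - \<i>) / of_real R)) / - 2) \<longlongrightarrow>
    (1 - \<i> * of_real \<beta>) / 2) at_top"
    by (simp only:)
  have "eventually (\<lambda>R. (jost_deriv q (of_real R * of_real \<beta>) / of_real R * jost_value q (of_real R * - \<i>)
      - jost_value q (of_real R * of_real \<beta>) * (jost_deriv q (of_real R * - \<i>) / of_real R)) / - 2 =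
     C11 q \<beta> (\<i> * of_real R)) at_top"
    using eventually_gt_at_top[of "0::real"]
  proof eventually_elim
    case (elim R)
    show ?case
      using C11_eq[OF imaginary_C11_dom[OF elim \<beta>]] elim
      by (simp add: field_simps)
  qed
  then show ?thesis by (rule Lim_transform_eventually[OF lim])
qed

end

section \<open>From the diagonal numbers back to the coefficients\<close>

lemma V_cong:
  assumes d: "\<And>n. 1 \<le> n \<Longrightarrow> V q n n = V q' n n" and q: "\<And>j. 1 \<le> j \<Longrightarrow> j < a \<Longrightarrow> q j = q' j"
    and "s \<le> a"
  shows "V q n s = V q' n s"
  using \<open>s \<le> a\<close>
proof (induction s rule: less_induct)
  case (less s)
  consider "n < 1 \<or> s < n" | "1 \<le> n" "n = s" | "1 \<le> n" "n < s" by linarith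
  then show ?case
  proof cases
    case 3
    have "(\<Sum>m=n..<s. q (s - m) * V q n m) = (\<Sum>m=n..<s. q' (s - m) * V q' n m)"
      using less 3 by (intro sum.cong refl arg_cong2[where f = "(*)"] q) auto
    then show ?thesis using 3 by (simp add: V.simps[of _ n s])
  qed (use d V_eq_0 in auto)
qed

text \<open>\<open>V_diag\<close> gives \<open>q a\<close> from column a of \<open>V\<close>. By
  \<open>V_cong\<close> this column depends only on the diagonal numbers and on q below a, since
  \<open>V_rec\<close> in row n uses q at indices up to a - n only.\<close>

lemma coefficients_eq:
  assumes d: "\<And>n. 1 \<le> n \<Longrightarrow> V q n n = V q' n n" and "1 \<le> a"
  shows "q a = q' a"
  using \<open>1 \<le> a\<close>
proof (induction a rule: less_induct)
  case (less a)
  have "V q n a = V q' n a" for n by (rule V_cong[OF d less.IH]) auto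
  then show ?case using V_diag[OF less.prems, of q] V_diag[OF less.prems, of q'] by (simp add: add_eq_0_iff)
qed

text \<open>
  At z = - w = - i n / (2 beta) the coefficients C11 and C12 have poles with residues proportional
  to V q n n times C12(w) and V q n n times C11(w), and these two values do not both vanish.
\<close>

lemma V_diag_eq:
  assumes "square_summable q" "square_summable q'" and \<beta>: "\<beta> > 0" and n: "1 \<le> n"
    and C11: "\<And>z. z \<in> C11_dom \<beta> \<Longrightarrow> C11 q \<beta> z = C11 q' \<beta> z"
    and C12: "\<And>z. z \<in> C12_dom \<beta> \<Longrightarrow> C12 q \<beta> z = C12 q' \<beta> z"
  shows "V q n n = V q' n n"
proof (rule ccontr)
  interpret q: square_summable q by fact
  interpret q': square_summable q' by fact
  assume neq: "V q n n \<noteq> V q' n n"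
  let ?h = "of_nat n / 2 :: complex"
  define w where "w = \<i> * of_real (real n / (2 * \<beta>))"
  define k where "k t = - ?h + of_real t" for t :: real
  define z where "z t = \<i> / of_real \<beta> * k t" for t :: real
  let ?F = "at_right (0::real)"
  \<comment> \<open>Up to the factor - 2 i w these are C12 and C11 at w, because - i beta w = n/2.
    Hence they agree for q and q', and comparing the pole terms compares the diagonal
    numbers.\<close>
  define D where "D p = jost_deriv p ?h * jost_value p w - jost_value p ?h * jost_deriv p w" for p
  define E where "E p = jost_deriv p (- w) * jost_value p ?h - jost_value p (- w) * jost_deriv p ?h" for p
  have w: "w \<in> C11_dom \<beta>" "w \<in> C12_dom \<beta>" "w \<noteq> 0" "- \<i> * of_real \<beta> * w = ?h" "Re w = 0"
  proof -
    have pos: "real n / (2 * \<beta>) > 0" using n \<beta> by simp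
    show "w \<in> C11_dom \<beta>" "w \<in> C12_dom \<beta>" 
      unfolding w_def using imaginary_C11_dom[OF pos \<beta>] imaginary_C12_dom[OF pos \<beta>] by blast+
    show "w \<noteq> 0" "- \<i> * of_real \<beta> * w = ?h" "Re w = 0" using n \<beta> by (auto simp: w_def)
  qed
  have ev: "eventually (\<lambda>t::real. 0 < t \<and> t < 1 / 2) ?F"
    using eventually_at_right_real[of 0 "1 / 2"] by simp
  have dom: "eventually (\<lambda>t. k t \<in> f1_dom) ?F"
    unfolding k_def using ev by eventually_elim (rule half_integer_shift_dom, auto)
  have kz: "- \<i> * of_real \<beta> * z t = k t" for t using \<beta> by (simp add: z_def)
  have Cdom: "eventually (\<lambda>t. z t \<in> C11_dom \<beta> \<and> z t \<in> C12_dom \<beta>) ?F"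
    using ev dom
  proof eventually_elim
    case (elim t)
    have k0: "k t \<noteq> 0" 
    proof
      assume "k t = 0"
      then have "Re (k t) = 0" by simp
      then show False using elim(1) n by (simp add: k_def)
    qed
    have "z t = \<i> * of_real ((t - real n / 2) / \<beta>)" by (simp add: z_def k_def field_simps)
    then have "z t \<in> f1_dom" "- z t \<in> f1_dom" by (auto intro!: Re_gt_f1_dom)
    moreover have "z t \<in> f2_dom \<beta>"
      using elim(2) by (simp only: f2_dom_iff kz)
    moreover have "z t \<noteq> 0" using k0 \<beta> by (simp add: z_def)
    ultimately show ?case by (simp add: C11_dom_def C12_dom_def)
  qed
  have k: "(k \<longlongrightarrow> - ?h) ?F" unfolding k_def by (auto intro!: tendsto_eq_intros)
  have "(z \<longlongrightarrow> \<i> / of_real \<beta> * - ?h) ?F" unfolding z_def by (intro tendsto_intros k)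
  moreover have "\<i> / of_real \<beta> * - ?h = - w" by (simp add: w_def)
  ultimately have z: "(z \<longlongrightarrow> - w) ?F" by simp
  then have mz: "((\<lambda>t. - z t) \<longlongrightarrow> w) ?F" using tendsto_minus by fastforce
  have lims: "((\<lambda>t. (of_nat n + 2 * k t) * (2 * \<i> * z t * C11 p \<beta> (z t))) \<longlongrightarrow> V p n n * D p) ?F"
    "((\<lambda>t. (of_nat n + 2 * k t) * (2 * \<i> * z t * C12 p \<beta> (z t))) \<longlongrightarrow> V p n n * E p) ?F"
    if "square_summable p" for p
  proof -
    interpret p: square_summable p by fact
    let ?c = "\<lambda>t. of_nat n + 2 * k t"
    note res = p.jost_residue[OF n _ k dom]
    have cw: "((\<lambda>t. jost_value p (- z t)) \<longlongrightarrow> jost_value p w) ?F"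
         "((\<lambda>t. jost_deriv p (- z t)) \<longlongrightarrow> jost_deriv p w) ?F"
         "((\<lambda>t. jost_value p (z t)) \<longlongrightarrow> jost_value p (- w)) ?F"
         "((\<lambda>t. jost_deriv p (z t)) \<longlongrightarrow> jost_deriv p (- w)) ?F"
      using w(5) by (auto intro!: isCont_tendsto_compose[OF _ mz] isCont_tendsto_compose[OF _ z] p.isCont_jost)
    have "((\<lambda>t. ?c t * jost_deriv p (k t) * jost_value p (- z t) - ?c t * jost_value p (k t) * jost_deriv p (- z t))
      \<longlongrightarrow> V p n n * jost_deriv p ?h * jost_value p w - V p n n * jost_value p ?h * jost_deriv p w) ?F"
      by (intro tendsto_diff tendsto_mult cw res) auto
    then have l1: "((\<lambda>t. ?c t * jost_deriv p (k t) * jost_value p (- z t) - ?c t * jost_value p (k t) * jost_deriv p (- z t))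
      \<longlongrightarrow> V p n n * D p) ?F"
      by (simp add: D_def algebra_simps)
    have "eventually (\<lambda>t. ?c t * jost_deriv p (k t) * jost_value p (- z t) - ?c t * jost_value p (k t) * jost_deriv p (- z t)
      = ?c t * (2 * \<i> * z t * C11 p \<beta> (z t))) ?F"
      using Cdom by eventually_elim (simp only: p.C11_eq kz, simp add: algebra_simps)
    then show "((\<lambda>t. ?c t * (2 * \<i> * z t * C11 p \<beta> (z t))) \<longlongrightarrow> V p n n * D p) ?F"
      by (rule Lim_transform_eventually[OF l1])
    have "((\<lambda>t. jost_deriv p (z t) * (?c t * jost_value p (k t)) - jost_value p (z t) * (?c t * jost_deriv p (k t)))
      \<longlongrightarrow> jost_deriv p (- w) * (V p n n * jost_value p ?h) - jost_value p (- w) * (V p n n * jost_deriv p ?h)) ?F"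
      by (intro tendsto_diff tendsto_mult cw res) auto
    then have l2: "((\<lambda>t. jost_deriv p (z t) * (?c t * jost_value p (k t)) - jost_value p (z t) * (?c t * jost_deriv p (k t)))
      \<longlongrightarrow> V p n n * E p) ?F"
      by (simp add: E_def algebra_simps)
    have "eventually (\<lambda>t. jost_deriv p (z t) * (?c t * jost_value p (k t)) - jost_value p (z t) * (?c t * jost_deriv p (k t))
      = ?c t * (2 * \<i> * z t * C12 p \<beta> (z t))) ?F"
      using Cdom by eventually_elim (simp only: p.C12_eq kz, simp add: algebra_simps)
    then show "((\<lambda>t. ?c t * (2 * \<i> * z t * C12 p \<beta> (z t))) \<longlongrightarrow> V p n n * E p) ?F"
      by (rule Lim_transform_eventually[OF l2])
  qed
  have "((\<lambda>t. (of_nat n + 2 * k t) * (2 * \<i> * z t * C11 q \<beta> (z t))) \<longlongrightarrow> V q' n n * D q') ?F"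
    by (rule Lim_transform_eventually[OF lims(1)[OF assms(2)]], use Cdom in eventually_elim) (simp add: C11)
  then have D: "V q n n * D q = V q' n n * D q'"
    by (rule tendsto_unique[OF trivial_limit_at_right_real lims(1)[OF assms(1)]])
  have "((\<lambda>t. (of_nat n + 2 * k t) * (2 * \<i> * z t * C12 q \<beta> (z t))) \<longlongrightarrow> V q' n n * E q') ?F"
    by (rule Lim_transform_eventually[OF lims(2)[OF assms(2)]], use Cdom in eventually_elim) (simp add: C12)
  then have E: "V q n n * E q = V q' n n * E q'"
    by (rule tendsto_unique[OF trivial_limit_at_right_real lims(2)[OF assms(1)]])
  have DC: "D p = - (2 * \<i> * w * C12 p \<beta> w)" and EC: "E p = - (2 * \<i> * w * C11 p \<beta> w)"
    if "square_summable p" for p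
  proof -
    interpret p: square_summable p by fact
    show "D p = - (2 * \<i> * w * C12 p \<beta> w)" "E p = - (2 * \<i> * w * C11 p \<beta> w)"
      unfolding D_def E_def p.C11_eq[OF w(1)] p.C12_eq[OF w(2)] w(4) by (simp_all add: algebra_simps)
  qed
  have "D q = D q'" "E q = E q'"
    using DC EC assms(1,2) C11[OF w(1)] C12[OF w(2)] by simp_all
  with D E neq have D0: "D q = 0" and E0: "E q = 0" by auto
  have wr: "jost_deriv q w * jost_value q (- w) - jost_value q w * jost_deriv q (- w) = 2 * \<i> * w"
    using w by (intro q.jost_wronskian Re_gt_f1_dom) auto
  \<comment> \<open>Cramer's rule: the data at n/2 are expanded in the basis formed by the data at w
    and - w, and the coordinates are multiples of \<open>E q\<close> and \<open>D q\<close>.\<close>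
  have "jost_value q ?h * (2 * \<i> * w) = - jost_value q (- w) * D q - jost_value q w * E q"
    unfolding wr[symmetric] D_def E_def by (simp add: algebra_simps)
  then have "jost_value q ?h = 0" using D0 E0 w by simp
  moreover have "jost_deriv q ?h * (2 * \<i> * w) = - jost_deriv q (- w) * D q - jost_deriv q w * E q"
    unfolding wr[symmetric] D_def E_def by (simp add: algebra_simps)
  then have "jost_deriv q ?h = 0" using D0 E0 w by simp
  ultimately show False using q.jost_nonzero[OF n] by simp
qed

theorem theorem2:
  fixes q q' :: "nat \<Rightarrow> complex" and Q Q' :: "real \<Rightarrow> complex" and \<beta> \<beta>' :: real
  assumes "summable (\<lambda>n. (norm (q n))\<^sup>2)" and "summable (\<lambda>n. (norm (q' n))\<^sup>2)"
    and "has_fourier_series Q q" and "has_fourier_series Q' q'"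
    and "\<beta> > 0" and "\<beta>' > 0"
    and "same_spectral_data Q q \<beta> Q' q' \<beta>'"
  shows "\<beta> = \<beta>' \<and> (\<forall>n\<ge>1. q n = q' n)"
proof -
  have s: "square_summable q" "square_summable q'" using assms(1,2) by unfold_locales
  have C11: "C11 q \<beta> z = C11 q' \<beta>' z" if "z \<in> C11_dom \<beta>" "z \<in> C11_dom \<beta>'" for z
    using assms(7) that by (auto simp: same_spectral_data_def)
  have C12: "C12 q \<beta> z = C12 q' \<beta>' z" if "z \<in> C12_dom \<beta>" "z \<in> C12_dom \<beta>'" for z
    using assms(7) that by (auto simp: same_spectral_data_def)
  have "eventually (\<lambda>R. C11 q' \<beta>' (\<i> * of_real R) = C11 q \<beta> (\<i> * of_real R)) at_top"
    using eventually_gt_at_top[of "0::real"]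
    by eventually_elim (use C11 imaginary_C11_dom assms(5,6) in auto)
  then have "((\<lambda>R. C11 q \<beta> (\<i> * of_real R)) \<longlongrightarrow> (1 - \<i> * of_real \<beta>') / 2) at_top"
    by (rule Lim_transform_eventually[OF square_summable.C11_asymptotics[OF s(2) assms(6)]])
  then have "(1 - \<i> * of_real \<beta>) / 2 = (1 - \<i> * of_real \<beta>') / 2"
    by (rule tendsto_unique[OF trivial_limit_at_top_linorder square_summable.C11_asymptotics[OF s(1) assms(5)]])
  then have \<beta>: "\<beta> = \<beta>'" by simp
  \<comment> \<open>Once \<beta> = \<beta>', the intersections in \<open>same_spectral_data\<close>
    are the full domains, so the coefficients agree near every pole.\<close>
  have "V q n n = V q' n n" if "1 \<le> n" for n
    using V_diag_eq[OF s assms(5) that] C11 C12 \<beta> by blast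
  then have "q n = q' n" if "1 \<le> n" for n using coefficients_eq that by blast
  with \<beta> show ?thesis by blast
qed

end
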